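(* Let $(M,\Delta_\diamond,\Delta_\bullet,\alpha_M)$ be a comodule over the post-Hom-Lie coalgebra $(L,\gamma,\Delta_\cdot,\alpha)$. For any non-negative integer $n$, define $$\Delta_\diamond^{n,0}=(\alpha^n\otimes \mathrm{Id}_M)\circ\Delta_\diamond:M\to L\otimes M,\qquad \Delta_\bullet^{n,0}=(\alpha^n\otimes \mathrm{Id}_M)\circ\Delta_\bullet:M\to L\otimes M .$$ Then $(M,\Delta_\diamond^{n,0},\Delta_\bullet^{n,0},\alpha_M)$ is a comodule over $(L,\gamma,\Delta_\cdot,\alpha)$.
   Context: All vector spaces are over a field $\mathbb{F}$ of characteristic $0$; $I$ is the identity map, $\tau(x\otimes y)=y\otimes x$, $\xi(x\otimes y\otimes z)=y\otimes z\otimes x$, $\xi^2(x\otimes y\otimes z)=z\otimes x\otimes y$. A post-Hom-Lie coalgebra $(L,\gamma,\Delta_\cdot,\alpha)$ is a vector space $L$ with linear maps $\gamma,\Delta_\cdot:L\to L\otimes L$ and $\alpha:L\to L$ such that (i) $\gamma=-\tau\circ\gamma$ and $\gamma\circ\alpha=(\alpha\otimes\alpha)\circ\gamma$; (ii) $(1+\xi+\xi^2)\circ(\alpha\otimes\gamma)\circ\gamma=0$; (iii) $(\alpha\otimes\gamma)\circ\Delta_\cdot-(\Delta_\cdot\otimes\alpha)\circ\gamma-(\tau\otimes I)\circ(\alpha\otimes\Delta_\cdot)\circ\gamma=0$; (iv) $(\Delta_\cdot\otimes\alpha)\circ\Delta_\cdot-(\alpha\otimes\Delta_\cdot)\circ\Delta_\cdot-(\tau\otimes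 I)\circ(\Delta_\cdot\otimes\alpha)\circ\Delta_\cdot+(\tau\otimes I)\circ(\alpha\otimes\Delta_\cdot)\circ\Delta_\cdot+(\gamma\otimes\alpha)\circ\Delta_\cdot=0$. A comodule over $L$ is a tuple $(M,\Delta_\diamond,\Delta_\bullet,\alpha_M)$ with $M$ a vector space, $\alpha_M:M\to M$ linear, and linear maps $\Delta_\diamond,\Delta_\bullet:M\to L\otimes M$ such that (a) $\Delta_\diamond\circ\alpha_M=(\alpha\otimes\alpha_M)\circ\Delta_\diamond$ and $\Delta_\bullet\circ\alpha_M=(\alpha\otimes\alpha_M)\circ\Delta_\bullet$; (b) $(\gamma\otimes\alpha_M)\circ\Delta_\diamond=(\alpha\otimes\Delta_\diamond)\circ\Delta_\diamond-(\tau\otimes \mathrm{Id}_M)\circ(\alpha\otimes\Delta_\diamond)\circ\Delta_\diamond$; (c) $(\Delta_\cdot\otimes\alpha_M)\circ\Delta_\diamond=(\alpha\otimes\Delta_\diamond)\circ\Delta_\bullet-(\tau\otimes \mathrm{Id}_M)\circ(\alpha\otimes\Delta_\bullet)\circ\Delta_\diamond$; (d) $(\gamma\otimes\alpha_M)\circ\Delta_\bullet=(1-\tau\otimes \mathrm{Id}_M)\circ(\alpha\otimes\Delta_\bullet)\circ\Delta_\bullet+(\tau\otimes \mathrm{Id}_M-1)\circ(\Delta_\cdot\otimes\alpha_M)\circ\Delta_\bullet$.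
   Formalization: The formal theorem additionally assumes that α is comultiplicative for Δ_·, i.e. Δ_·∘α = (α⊗α)∘Δ_·; without this the claim fails already for n = 1 (condition (d) can break). *)

theory Defs
  imports "HOL-Algebra.Module" "HOL-Algebra.AbelCoset"
begin

section \<open>Linear and bilinear maps\<close>

definition linear_maps ::
  "('f, 'r) ring_scheme \<Rightarrow> ('f, 'a, 's) module_scheme \<Rightarrow> ('f, 'b, 't) module_scheme \<Rightarrow> ('a \<Rightarrow> 'b) set"
  where "linear_maps R M N =
    {f. f \<in> carrier M \<rightarrow> carrier N \<and>
        (\<forall>x\<in>carrier M. \<forall>y\<in>carrier M. f (x \<oplus>\<^bsub>M\<^esub> y) = f x \<oplus>\<^bsub>N\<^esub> f y) \<and>
        (\<forall>a\<in>carrier R. \<forall>x\<in>carrier M. f (a \<odot>\<^bsub>M\<^esub> x) = a \<odot>\<^bsub>N\<^esub> f x)}"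

definition bilinear_maps ::
  "('f, 'r) ring_scheme \<Rightarrow> ('f, 'a, 's) module_scheme \<Rightarrow> ('f, 'b, 't) module_scheme
    \<Rightarrow> ('f, 'c, 'u) module_scheme \<Rightarrow> ('a \<Rightarrow> 'b \<Rightarrow> 'c) set"
  where "bilinear_maps R M N P =
    {b. (\<forall>x\<in>carrier M. b x \<in> linear_maps R N P) \<and>
        (\<forall>y\<in>carrier N. (\<lambda>x. b x y) \<in> linear_maps R M P)}"

section \<open>Free modules, quotient modules and tensor products\<close>

text \<open>The multiplicative components of a module record play no role.\<close>

definition free_module :: "('f, 'r) ring_scheme \<Rightarrow> 'x set \<Rightarrow> ('f, 'x \<Rightarrow> 'f) module"
  where "free_module R X =
    \<lparr>carrier = {\<phi>. (\<forall>x\<in>X. \<phi> x \<in> carrier R) \<and> (\<forall>x. x \<notin> X \<longrightarrow> \<phi> x = \<zero>\<^bsub>R\<^esub>) \<and>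
                   finite {x. \<phi> x \<noteq> \<zero>\<^bsub>R\<^esub>}},
     mult = undefined, one = undefined,
     zero = (\<lambda>x. \<zero>\<^bsub>R\<^esub>), add = (\<lambda>\<phi> \<psi> x. \<phi> x \<oplus>\<^bsub>R\<^esub> \<psi> x),
     smult = (\<lambda>a \<phi> x. a \<otimes>\<^bsub>R\<^esub> \<phi> x)\<rparr>"

definition free_gen :: "('f, 'r) ring_scheme \<Rightarrow> 'x \<Rightarrow> 'x \<Rightarrow> 'f"
  where "free_gen R x = (\<lambda>y. if y = x then \<one>\<^bsub>R\<^esub> else \<zero>\<^bsub>R\<^esub>)"

definition quotient_module :: "('f, 'a, 's) module_scheme \<Rightarrow> 'a set \<Rightarrow> ('f, 'a set) module"
  where "quotient_module M H =
    \<lparr>carrier = a_rcosets\<^bsub>M\<^esub> H,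
     mult = undefined, one = undefined,
     zero = H, add = (\<lambda>A B. A <+>\<^bsub>M\<^esub> B),
     smult = (\<lambda>a A. \<Union>x\<in>A. H +>\<^bsub>M\<^esub> (a \<odot>\<^bsub>M\<^esub> x))\<rparr>"

definition bilinear_relations ::
  "('f, 'r) ring_scheme \<Rightarrow> ('f, 'a, 's) module_scheme \<Rightarrow> ('f, 'b, 't) module_scheme \<Rightarrow> ('a \<times> 'b \<Rightarrow> 'f) set"
  where "bilinear_relations R M N =
    (let F = free_module R (carrier M \<times> carrier N); g = (\<lambda>x y. free_gen R (x, y)) in
      {g (x \<oplus>\<^bsub>M\<^esub> x') y \<ominus>\<^bsub>F\<^esub> (g x y \<oplus>\<^bsub>F\<^esub> g x' y) | x x' y.
         x \<in> carrier M \<and> x' \<in> carrier M \<and> y \<in> carrier N}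
    \<union> {g x (y \<oplus>\<^bsub>N\<^esub> y') \<ominus>\<^bsub>F\<^esub> (g x y \<oplus>\<^bsub>F\<^esub> g x y') | x y y'.
         x \<in> carrier M \<and> y \<in> carrier N \<and> y' \<in> carrier N}
    \<union> {g (a \<odot>\<^bsub>M\<^esub> x) y \<ominus>\<^bsub>F\<^esub> a \<odot>\<^bsub>F\<^esub> g x y | a x y.
         a \<in> carrier R \<and> x \<in> carrier M \<and> y \<in> carrier N}
    \<union> {g x (a \<odot>\<^bsub>N\<^esub> y) \<ominus>\<^bsub>F\<^esub> a \<odot>\<^bsub>F\<^esub> g x y | a x y.
         a \<in> carrier R \<and> x \<in> carrier M \<and> y \<in> carrier N})"

definition tensor_null ::
  "('f, 'r) ring_scheme \<Rightarrow> ('f, 'a, 's) module_scheme \<Rightarrow> ('f, 'b, 't) module_scheme \<Rightarrow> ('a \<times> 'b \<Rightarrow> 'f) set"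
  where "tensor_null R M N =
    \<Inter> {H. submodule H R (free_module R (carrier M \<times> carrier N)) \<and> bilinear_relations R M N \<subseteq> H}"

definition tensor ::
  "('f, 'r) ring_scheme \<Rightarrow> ('f, 'a, 's) module_scheme \<Rightarrow> ('f, 'b, 't) module_scheme
    \<Rightarrow> ('f, ('a \<times> 'b \<Rightarrow> 'f) set) module"
  where "tensor R M N =
    quotient_module (free_module R (carrier M \<times> carrier N)) (tensor_null R M N)"

definition pure_tensor ::
  "('f, 'r) ring_scheme \<Rightarrow> ('f, 'a, 's) module_scheme \<Rightarrow> ('f, 'b, 't) module_scheme
    \<Rightarrow> 'a \<Rightarrow> 'b \<Rightarrow> ('a \<times> 'b \<Rightarrow> 'f) set"
  where "pure_tensor R M N x y =
    tensor_null R M N +>\<^bsub>free_module R (carrier M \<times> carrier N)\<^esub> free_gen R (x, y)"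

definition free_eval ::
  "('f, 'r) ring_scheme \<Rightarrow> ('f, 'c, 'u) module_scheme \<Rightarrow> ('x \<Rightarrow> 'c) \<Rightarrow> ('x \<Rightarrow> 'f) \<Rightarrow> 'c"
  where "free_eval R P b \<phi> = (\<Oplus>\<^bsub>P\<^esub>p\<in>{p. \<phi> p \<noteq> \<zero>\<^bsub>R\<^esub>}. \<phi> p \<odot>\<^bsub>P\<^esub> b p)"

text \<open>
  The linear map with values in \<open>P\<close> induced on a tensor product by a bilinear map \<open>b\<close>.
  The value does not depend on the chosen representative, and the map is characterised by
  \<open>x \<otimes> y \<mapsto> b x y\<close>: see \<open>tensor_lift_linear\<close>, \<open>tensor_lift_pure\<close> and
  \<open>tensor_lift_unique\<close> below.
\<close>

definition tensor_lift ::
  "('f, 'r) ring_scheme \<Rightarrow> ('f, 'c, 'u) module_scheme \<Rightarrow> ('a \<Rightarrow> 'b \<Rightarrow> 'c)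
    \<Rightarrow> ('a \<times> 'b \<Rightarrow> 'f) set \<Rightarrow> 'c"
  where "tensor_lift R P b A = free_eval R P (\<lambda>p. b (fst p) (snd p)) (SOME \<phi>. \<phi> \<in> A)"

text \<open>
  For the maps below the module arguments fix the codomain: \<open>tensor_map R P Q f g\<close> is
  \<open>f \<otimes> g\<close> with values in \<open>P \<otimes> Q\<close>.
\<close>

definition tensor_map ::
  "('f, 'r) ring_scheme \<Rightarrow> ('f, 'c, 's) module_scheme \<Rightarrow> ('f, 'd, 't) module_scheme
    \<Rightarrow> ('a \<Rightarrow> 'c) \<Rightarrow> ('b \<Rightarrow> 'd) \<Rightarrow> ('a \<times> 'b \<Rightarrow> 'f) set \<Rightarrow> ('c \<times> 'd \<Rightarrow> 'f) set"
  where "tensor_map R P Q f g =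
    tensor_lift R (tensor R P Q) (\<lambda>x y. pure_tensor R P Q (f x) (g y))"

text \<open>\<open>\<tau>(x \<otimes> y) = y \<otimes> x\<close> on \<open>L \<otimes> L\<close>.\<close>

definition tensor_swap ::
  "('f, 'r) ring_scheme \<Rightarrow> ('f, 'a, 's) module_scheme
    \<Rightarrow> ('a \<times> 'a \<Rightarrow> 'f) set \<Rightarrow> ('a \<times> 'a \<Rightarrow> 'f) set"
  where "tensor_swap R L = tensor_lift R (tensor R L L) (\<lambda>x y. pure_tensor R L L y x)"

text \<open>
  The identification \<open>x \<otimes> (y \<otimes> z) \<mapsto> (x \<otimes> y) \<otimes> z\<close> of \<open>M \<otimes> (N \<otimes> P)\<close> with
  \<open>(M \<otimes> N) \<otimes> P\<close>. All identities in threefold tensor products are stated in \<open>(M \<otimes> N) \<otimes> P\<close>.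
\<close>

definition tensor_assoc ::
  "('f, 'r) ring_scheme \<Rightarrow> ('f, 'a, 's) module_scheme \<Rightarrow> ('f, 'b, 't) module_scheme
    \<Rightarrow> ('f, 'c, 'u) module_scheme
    \<Rightarrow> ('a \<times> ('b \<times> 'c \<Rightarrow> 'f) set \<Rightarrow> 'f) set \<Rightarrow> (('a \<times> 'b \<Rightarrow> 'f) set \<times> 'c \<Rightarrow> 'f) set"
  where "tensor_assoc R M N P =
    (let T = tensor R (tensor R M N) P in
      tensor_lift R T (\<lambda>x. tensor_lift R T
        (\<lambda>y z. pure_tensor R (tensor R M N) P (pure_tensor R M N x y) z)))"

text \<open>\<open>\<xi>((x \<otimes> y) \<otimes> z) = (y \<otimes> z) \<otimes> x\<close> on \<open>(L \<otimes> L) \<otimes> L\<close>.\<close>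

definition tensor_cycle ::
  "('f, 'r) ring_scheme \<Rightarrow> ('f, 'a, 's) module_scheme
    \<Rightarrow> (('a \<times> 'a \<Rightarrow> 'f) set \<times> 'a \<Rightarrow> 'f) set \<Rightarrow> (('a \<times> 'a \<Rightarrow> 'f) set \<times> 'a \<Rightarrow> 'f) set"
  where "tensor_cycle R L =
    (let T = tensor R (tensor R L L) L in
      tensor_lift R T (\<lambda>t z. tensor_lift R T
        (\<lambda>x y. pure_tensor R (tensor R L L) L (pure_tensor R L L y z) x) t))"

section \<open>Post-Hom-Lie coalgebras and their comodules\<close>

locale field_char_zero = field R for R (structure) +
  assumes char_zero: "\<And>n::nat. n > 0 \<Longrightarrow> [n] \<cdot>\<^bsub>R\<^esub> \<one>\<^bsub>R\<^esub> \<noteq> \<zero>\<^bsub>R\<^esub>"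

text \<open>
  \<open>\<alpha>\<close> is required to be compatible with \<open>\<gamma>\<close> but not with \<open>\<Delta>\<close>. The identity
  \<open>\<Delta> \<circ> \<alpha> = (\<alpha> \<otimes> \<alpha>) \<circ> \<Delta>\<close> is not a consequence of the axioms: take \<open>L\<close> with basis
  \<open>f, k\<close>, \<open>\<gamma> = 0\<close>, \<open>\<Delta> f = f \<otimes> k\<close>, \<open>\<Delta> k = 0\<close>, \<open>\<alpha> f = f\<close>, \<open>\<alpha> k = 0\<close>.
\<close>

locale post_hom_lie_coalgebra = field_char_zero R + L: module R L
  for R :: "('f, 'r) ring_scheme" (structure) and L :: "('f, 'l, 's) module_scheme" +
  fixes \<gamma> \<Delta> :: "'l \<Rightarrow> ('l \<times> 'l \<Rightarrow> 'f) set" and \<alpha> :: "'l \<Rightarrow> 'l"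
  assumes \<gamma>_linear: "\<gamma> \<in> linear_maps R L (tensor R L L)"
    and \<Delta>_linear: "\<Delta> \<in> linear_maps R L (tensor R L L)"
    and \<alpha>_linear: "\<alpha> \<in> linear_maps R L L"
    and \<gamma>_skew: "\<And>x. x \<in> carrier L \<Longrightarrow>
      \<gamma> x = \<ominus>\<^bsub>tensor R L L\<^esub> tensor_swap R L (\<gamma> x)"
    and \<gamma>_\<alpha>: "\<And>x. x \<in> carrier L \<Longrightarrow>
      \<gamma> (\<alpha> x) = tensor_map R L L \<alpha> \<alpha> (\<gamma> x)"
    and hom_jacobi: "\<And>x. x \<in> carrier L \<Longrightarrow>
      (let T = tensor R (tensor R L L) L; \<xi> = tensor_cycle R L;
           t = tensor_assoc R L L L (tensor_map R L (tensor R L L) \<alpha> \<gamma> (\<gamma> x))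
       in t \<oplus>\<^bsub>T\<^esub> \<xi> t \<oplus>\<^bsub>T\<^esub> \<xi> (\<xi> t) = \<zero>\<^bsub>T\<^esub>)"
    and post_lie1: "\<And>x. x \<in> carrier L \<Longrightarrow>
      (let LL = tensor R L L; T = tensor R LL L; \<tau>I = tensor_map R LL L (tensor_swap R L) id
       in tensor_assoc R L L L (tensor_map R L LL \<alpha> \<gamma> (\<Delta> x))
          \<ominus>\<^bsub>T\<^esub> tensor_map R LL L \<Delta> \<alpha> (\<gamma> x)
          \<ominus>\<^bsub>T\<^esub> \<tau>I (tensor_assoc R L L L (tensor_map R L LL \<alpha> \<Delta> (\<gamma> x))) = \<zero>\<^bsub>T\<^esub>)"
    and post_lie2: "\<And>x. x \<in> carrier L \<Longrightarrow>
      (let LL = tensor R L L; T = tensor R LL L; \<tau>I = tensor_map R LL L (tensor_swap R L) id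
       in tensor_map R LL L \<Delta> \<alpha> (\<Delta> x)
          \<ominus>\<^bsub>T\<^esub> tensor_assoc R L L L (tensor_map R L LL \<alpha> \<Delta> (\<Delta> x))
          \<ominus>\<^bsub>T\<^esub> \<tau>I (tensor_map R LL L \<Delta> \<alpha> (\<Delta> x))
          \<oplus>\<^bsub>T\<^esub> \<tau>I (tensor_assoc R L L L (tensor_map R L LL \<alpha> \<Delta> (\<Delta> x)))
          \<oplus>\<^bsub>T\<^esub> tensor_map R LL L \<gamma> \<alpha> (\<Delta> x) = \<zero>\<^bsub>T\<^esub>)"

text \<open>In the following locale \<open>\<delta>\<close> stands for \<open>\<Delta>\<^sub>\<diamond>\<close> and \<open>\<beta>\<close> for \<open>\<Delta>\<^sub>\<bullet>\<close>.\<close>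

locale post_hom_lie_comodule = post_hom_lie_coalgebra R L \<gamma> \<Delta> \<alpha> + M: module R M
  for R :: "('f, 'r) ring_scheme" (structure) and L :: "('f, 'l, 's) module_scheme"
    and \<gamma> \<Delta> :: "'l \<Rightarrow> ('l \<times> 'l \<Rightarrow> 'f) set" and \<alpha> :: "'l \<Rightarrow> 'l"
    and M :: "('f, 'm, 't) module_scheme" +
  fixes \<delta> \<beta> :: "'m \<Rightarrow> ('l \<times> 'm \<Rightarrow> 'f) set" and \<alpha>\<^sub>M :: "'m \<Rightarrow> 'm"
  assumes \<delta>_linear: "\<delta> \<in> linear_maps R M (tensor R L M)"
    and \<beta>_linear: "\<beta> \<in> linear_maps R M (tensor R L M)"
    and \<alpha>\<^sub>M_linear: "\<alpha>\<^sub>M \<in> linear_maps R M M"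
    and \<delta>_\<alpha>\<^sub>M: "\<And>m. m \<in> carrier M \<Longrightarrow> \<delta> (\<alpha>\<^sub>M m) = tensor_map R L M \<alpha> \<alpha>\<^sub>M (\<delta> m)"
    and \<beta>_\<alpha>\<^sub>M: "\<And>m. m \<in> carrier M \<Longrightarrow> \<beta> (\<alpha>\<^sub>M m) = tensor_map R L M \<alpha> \<alpha>\<^sub>M (\<beta> m)"
    and comodule_\<delta>\<delta>: "\<And>m. m \<in> carrier M \<Longrightarrow>
      (let LL = tensor R L L; LM = tensor R L M; T = tensor R LL M;
           \<tau>I = tensor_map R LL M (tensor_swap R L) id;
           t = tensor_assoc R L L M (tensor_map R L LM \<alpha> \<delta> (\<delta> m))
       in tensor_map R LL M \<gamma> \<alpha>\<^sub>M (\<delta> m) = t \<ominus>\<^bsub>T\<^esub> \<tau>I t)"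
    and comodule_\<delta>\<beta>: "\<And>m. m \<in> carrier M \<Longrightarrow>
      (let LL = tensor R L L; LM = tensor R L M; T = tensor R LL M;
           \<tau>I = tensor_map R LL M (tensor_swap R L) id
       in tensor_map R LL M \<Delta> \<alpha>\<^sub>M (\<delta> m) =
          tensor_assoc R L L M (tensor_map R L LM \<alpha> \<delta> (\<beta> m))
          \<ominus>\<^bsub>T\<^esub> \<tau>I (tensor_assoc R L L M (tensor_map R L LM \<alpha> \<beta> (\<delta> m))))"
    and comodule_\<beta>\<beta>: "\<And>m. m \<in> carrier M \<Longrightarrow>
      (let LL = tensor R L L; LM = tensor R L M; T = tensor R LL M;
           \<tau>I = tensor_map R LL M (tensor_swap R L) id;
           t = tensor_assoc R L L M (tensor_map R L LM \<alpha> \<beta> (\<beta> m));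
           s = tensor_map R LL M \<Delta> \<alpha>\<^sub>M (\<beta> m)
       in tensor_map R LL M \<gamma> \<alpha>\<^sub>M (\<beta> m) = (t \<ominus>\<^bsub>T\<^esub> \<tau>I t) \<oplus>\<^bsub>T\<^esub> (\<tau>I s \<ominus>\<^bsub>T\<^esub> s))"

section \<open>The universal property of the tensor product\<close>

lemma free_module_module:
  assumes "cring R"
  shows "module R (free_module R X)"
proof -
  interpret cring R by fact
  show ?thesis
  proof (rule moduleI)
    show "cring R" by fact
    show "abelian_group (free_module R X)"
    proof (rule abelian_groupI)
      fix \<phi> \<psi> assume a: "\<phi> \<in> carrier (free_module R X)" "\<psi> \<in> carrier (free_module R X)"
      have "finite {x. \<phi> x \<oplus>\<^bsub>R\<^esub> \<psi> x \<noteq> \<zero>\<^bsub>R\<^esub>}"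
        by (rule finite_subset[of _ "{x. \<phi> x \<noteq> \<zero>\<^bsub>R\<^esub>} \<union> {x. \<psi> x \<noteq> \<zero>\<^bsub>R\<^esub>}"])
          (use a in \<open>auto simp: free_module_def\<close>)
      then show "\<phi> \<oplus>\<^bsub>free_module R X\<^esub> \<psi> \<in> carrier (free_module R X)"
        using a by (auto simp: free_module_def)
    next
      fix \<phi> assume a: "\<phi> \<in> carrier (free_module R X)"
      have "finite {x. \<ominus>\<^bsub>R\<^esub> \<phi> x \<noteq> \<zero>\<^bsub>R\<^esub>}"
        by (rule finite_subset[of _ "{x. \<phi> x \<noteq> \<zero>\<^bsub>R\<^esub>}"]) (use a in \<open>auto simp: free_module_def\<close>)
      moreover have "\<phi> x \<in> carrier R" for x
        using a by (cases "x \<in> X") (auto simp: free_module_def)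
      ultimately show "\<exists>\<psi>\<in>carrier (free_module R X). \<psi> \<oplus>\<^bsub>free_module R X\<^esub> \<phi> = \<zero>\<^bsub>free_module R X\<^esub>"
        using a by (intro bexI[of _ "\<lambda>x. \<ominus>\<^bsub>R\<^esub> \<phi> x"]) (auto simp: free_module_def l_neg)
    qed (auto simp: free_module_def fun_eq_iff, (metis a_assoc a_comm zero_closed l_zero)+)
  next
    fix a \<phi> assume a: "a \<in> carrier R" "\<phi> \<in> carrier (free_module R X)"
    have "finite {x. a \<otimes>\<^bsub>R\<^esub> \<phi> x \<noteq> \<zero>\<^bsub>R\<^esub>}"
      by (rule finite_subset[of _ "{x. \<phi> x \<noteq> \<zero>\<^bsub>R\<^esub>}"]) (use a in \<open>auto simp: free_module_def\<close>)
    then show "a \<odot>\<^bsub>free_module R X\<^esub> \<phi> \<in> carrier (free_module R X)"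
      using a by (auto simp: free_module_def)
  qed (auto simp: free_module_def fun_eq_iff, (metis l_distr r_distr m_assoc l_one zero_closed)+)
qed

lemma free_gen_closed:
  assumes "cring R" "x \<in> X" shows "free_gen R x \<in> carrier (free_module R X)"
proof -
  interpret cring R by fact
  have "finite {y. free_gen R x y \<noteq> \<zero>\<^bsub>R\<^esub>}"
    by (rule finite_subset[of _ "{x}"]) (auto simp: free_gen_def)
  then show ?thesis using assms by (auto simp: free_module_def free_gen_def)
qed


lemma linear_maps_closed: "f \<in> linear_maps R M N \<Longrightarrow> x \<in> carrier M \<Longrightarrow> f x \<in> carrier N"
  and linear_maps_add: "f \<in> linear_maps R M N \<Longrightarrow> x \<in> carrier M \<Longrightarrow> y \<in> carrier M \<Longrightarrow>
    f (x \<oplus>\<^bsub>M\<^esub> y) = f x \<oplus>\<^bsub>N\<^esub> f y"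
  and linear_maps_smult: "f \<in> linear_maps R M N \<Longrightarrow> a \<in> carrier R \<Longrightarrow> x \<in> carrier M \<Longrightarrow>
    f (a \<odot>\<^bsub>M\<^esub> x) = a \<odot>\<^bsub>N\<^esub> f x"
  by (auto simp: linear_maps_def)

lemma linear_maps_zero:
  assumes "module R M" "module R N" "f \<in> linear_maps R M N"
  shows "f \<zero>\<^bsub>M\<^esub> = \<zero>\<^bsub>N\<^esub>"
proof -
  interpret M: module R M by fact
  interpret N: module R N by fact
  have "f (\<zero>\<^bsub>R\<^esub> \<odot>\<^bsub>M\<^esub> \<zero>\<^bsub>M\<^esub>) = \<zero>\<^bsub>R\<^esub> \<odot>\<^bsub>N\<^esub> f \<zero>\<^bsub>M\<^esub>"
    using assms(3) by (intro linear_maps_smult) auto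
  then show ?thesis using assms(3) by (simp add: linear_maps_closed)
qed

lemma module_diff_zero:
  assumes "module R M" "x \<in> carrier M" "y \<in> carrier M"
  shows "x \<ominus>\<^bsub>M\<^esub> y = \<zero>\<^bsub>M\<^esub> \<longleftrightarrow> x = y"
proof -
  interpret M: module R M by fact
  show ?thesis using assms
    by (metis M.M.add.inv_solve_right M.M.l_zero M.M.r_neg M.M.zero_closed a_minus_def)
qed

lemma linear_maps_minus:
  assumes "module R M" "module R N" "f \<in> linear_maps R M N" "x \<in> carrier M" "y \<in> carrier M"
  shows "f (x \<ominus>\<^bsub>M\<^esub> y) = f x \<ominus>\<^bsub>N\<^esub> f y"
proof -
  interpret M: module R M by fact
  interpret N: module R N by fact
  have "f ((\<ominus>\<^bsub>R\<^esub> \<one>\<^bsub>R\<^esub>) \<odot>\<^bsub>M\<^esub> y) = (\<ominus>\<^bsub>R\<^esub> \<one>\<^bsub>R\<^esub>) \<odot>\<^bsub>N\<^esub> f y"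
    using assms by (intro linear_maps_smult) auto
  then have "f (\<ominus>\<^bsub>M\<^esub> y) = \<ominus>\<^bsub>N\<^esub> f y"
    using assms by (simp add: M.smult_l_minus N.smult_l_minus linear_maps_closed)
  then show ?thesis using assms
    by (simp add: a_minus_def linear_maps_add)
qed

lemma smult_rcoset:
  assumes "module R M" "submodule H R M" "a \<in> carrier R" "x \<in> carrier M"
  shows "a \<odot>\<^bsub>quotient_module M H\<^esub> (H +>\<^bsub>M\<^esub> x) = H +>\<^bsub>M\<^esub> (a \<odot>\<^bsub>M\<^esub> x)"
proof -
  interpret M: module R M by fact
  interpret H: submodule H R M by fact
  have sg: "subgroup H (add_monoid M)" by (rule H.subgroup_axioms)
  have HM: "H \<subseteq> carrier M" using H.subset by simp
  have *: "H +>\<^bsub>M\<^esub> (a \<odot>\<^bsub>M\<^esub> y) = H +>\<^bsub>M\<^esub> (a \<odot>\<^bsub>M\<^esub> x)" if y: "y \<in> H +>\<^bsub>M\<^esub> x" for y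
  proof -
    obtain h where h: "h \<in> H" "y = h \<oplus>\<^bsub>M\<^esub> x" using y by (auto simp: a_r_coset_def')
    have hM: "h \<in> carrier M" using h HM by auto
    have "a \<odot>\<^bsub>M\<^esub> y = a \<odot>\<^bsub>M\<^esub> h \<oplus>\<^bsub>M\<^esub> a \<odot>\<^bsub>M\<^esub> x" using h hM assms by (simp add: M.smult_r_distr)
    moreover have "a \<odot>\<^bsub>M\<^esub> h \<in> H" using h assms by simp
    ultimately have "a \<odot>\<^bsub>M\<^esub> y \<in> H +>\<^bsub>M\<^esub> (a \<odot>\<^bsub>M\<^esub> x)" by (auto simp: a_r_coset_def')
    then show ?thesis
      by (metis M.a_repr_independence' [unfolded a_r_coset_def[symmetric]] sg assms(3,4) M.smult_closed)
  qed
  have "\<zero>\<^bsub>M\<^esub> \<in> H" using subgroup.one_closed[OF sg] by simp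
  then have "x \<in> H +>\<^bsub>M\<^esub> x"
    using assms by (force simp: a_r_coset_def')
  with * have "(\<Union>y\<in>H +>\<^bsub>M\<^esub> x. H +>\<^bsub>M\<^esub> (a \<odot>\<^bsub>M\<^esub> y)) = H +>\<^bsub>M\<^esub> (a \<odot>\<^bsub>M\<^esub> x)"
    by blast
  then show ?thesis by (simp add: quotient_module_def)
qed

lemma carrier_quotient: "carrier (quotient_module M H) = {H +>\<^bsub>M\<^esub> x |x. x \<in> carrier M}"
  by (auto simp: quotient_module_def A_RCOSETS_def')

lemma add_rcoset:
  assumes "module R M" "submodule H R M" "x \<in> carrier M" "y \<in> carrier M"
  shows "(H +>\<^bsub>M\<^esub> x) \<oplus>\<^bsub>quotient_module M H\<^esub> (H +>\<^bsub>M\<^esub> y) = H +>\<^bsub>M\<^esub> (x \<oplus>\<^bsub>M\<^esub> y)"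
proof -
  interpret M: module R M by fact
  interpret H: submodule H R M by fact
  have "abelian_subgroup H M"
    by (rule abelian_subgroupI3) (simp_all add: additive_subgroup_def H.subgroup_axioms M.abelian_group_axioms)
  then show ?thesis using assms abelian_subgroup.a_rcos_sum by (fastforce simp: quotient_module_def)
qed

lemma quotient_module_module:
  assumes "module R M" "submodule H R M"
  shows "module R (quotient_module M H)"
proof -
  interpret M: module R M by fact
  interpret H: submodule H R M by fact
  show ?thesis
  proof (rule moduleI)
    show "cring R" by (rule M.R.is_cring)
    have z: "\<zero>\<^bsub>quotient_module M H\<^esub> = H +>\<^bsub>M\<^esub> \<zero>\<^bsub>M\<^esub>"
      using H.subset by (auto simp: quotient_module_def a_r_coset_def' subset_iff)
    show "abelian_group (quotient_module M H)"
    proof (rule abelian_groupI)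
      fix A assume "A \<in> carrier (quotient_module M H)"
      then obtain x where x: "x \<in> carrier M" "A = H +>\<^bsub>M\<^esub> x" by (auto simp: carrier_quotient)
      then show "\<exists>B\<in>carrier (quotient_module M H).
          B \<oplus>\<^bsub>quotient_module M H\<^esub> A = \<zero>\<^bsub>quotient_module M H\<^esub>"
        by (intro bexI[of _ "H +>\<^bsub>M\<^esub> (\<ominus>\<^bsub>M\<^esub> x)"])
          (auto simp: z add_rcoset[OF assms] M.l_neg carrier_quotient)
    qed (auto simp: z carrier_quotient add_rcoset[OF assms] M.a_assoc,
         auto simp: M.a_comm)
  qed (auto simp: carrier_quotient smult_rcoset[OF assms] add_rcoset[OF assms] M.smult_l_distr
        M.smult_r_distr M.smult_assoc1)
qed

lemma bilinear_relations_closed: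
  assumes "module R M" "module R N"
  shows "bilinear_relations R M N \<subseteq> carrier (free_module R (carrier M \<times> carrier N))"
proof -
  interpret M: module R M by fact
  interpret N: module R N by fact
  interpret F: module R "free_module R (carrier M \<times> carrier N)"
    by (rule free_module_module[OF M.R.is_cring])
  show ?thesis
    unfolding bilinear_relations_def Let_def
    by (auto intro!: F.M.minus_closed F.M.a_closed F.smult_closed free_gen_closed[OF M.R.is_cring])
qed

lemma tensor_null_submodule:
  assumes "module R M" "module R N"
  shows "submodule (tensor_null R M N) R (free_module R (carrier M \<times> carrier N))"
proof -
  interpret M: module R M by fact
  interpret N: module R N by fact
  interpret F: module R "free_module R (carrier M \<times> carrier N)"
    by (rule free_module_module[OF M.R.is_cring])
  show ?thesis
  proof (rule F.submoduleI)
    show "tensor_null R M N \<subseteq> carrier (free_module R (carrier M \<times> carrier N))"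
      unfolding tensor_null_def
      using F.carrier_is_submodule bilinear_relations_closed[OF assms] by blast
    show "\<zero>\<^bsub>free_module R (carrier M \<times> carrier N)\<^esub> \<in> tensor_null R M N"
      unfolding tensor_null_def by (auto simp: submodule_def dest: subgroup.one_closed)
  qed (auto simp: tensor_null_def dest: F.submoduleE submodule.smult_closed)
qed

lemma bilinear_relations_null: "bilinear_relations R M N \<subseteq> tensor_null R M N"
  by (auto simp: tensor_null_def)

lemma tensor_module:
  assumes "module R M" "module R N"
  shows "module R (tensor R M N)"
  unfolding tensor_def
  by (intro quotient_module_module tensor_null_submodule free_module_module assms)
    (use assms module.axioms(1) in auto)

lemma free_eval_superset:
  assumes "module R P" "b \<in> X \<rightarrow> carrier P" "\<phi> \<in> carrier (free_module R X)"
    and "finite S" "{x. \<phi> x \<noteq> \<zero>\<^bsub>R\<^esub>} \<subseteq> S" "S \<subseteq> X"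
  shows "free_eval R P b \<phi> = (\<Oplus>\<^bsub>P\<^esub>p\<in>S. \<phi> p \<odot>\<^bsub>P\<^esub> b p)"
proof -
  interpret P: module R P by fact
  show ?thesis unfolding free_eval_def
    by (rule P.M.add.finprod_mono_neutral_cong_left)
      (use assms in \<open>auto simp: free_module_def Pi_iff subset_iff\<close>)
qed

lemma free_eval_linear:
  assumes "module R P" "b \<in> X \<rightarrow> carrier P"
  shows "free_eval R P b \<in> linear_maps R (free_module R X) P"
proof -
  interpret P: module R P by fact
  interpret F: module R "free_module R X" by (rule free_module_module[OF P.R.is_cring])
  let ?s = "\<lambda>\<phi>. {x. \<phi> x \<noteq> \<zero>\<^bsub>R\<^esub>}"
  have supp: "finite (?s \<phi>) \<and> ?s \<phi> \<subseteq> X" if "\<phi> \<in> carrier (free_module R X)" for \<phi>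
    using that by (auto simp: free_module_def)
  have val: "\<phi> x \<in> carrier R" if "\<phi> \<in> carrier (free_module R X)" for \<phi> x
    using that by (cases "x \<in> X") (auto simp: free_module_def)
  have bX: "b x \<in> carrier P" if "x \<in> X" for x using that assms by auto
  show ?thesis unfolding linear_maps_def
  proof (intro CollectI conjI ballI)
    show "free_eval R P b \<in> carrier (free_module R X) \<rightarrow> carrier P"
    proof
      fix \<phi> assume "\<phi> \<in> carrier (free_module R X)"
      with supp[OF this] show "free_eval R P b \<phi> \<in> carrier P"
        unfolding free_eval_def by (intro P.M.finsum_closed) (auto simp: val bX subset_iff)
    qed
  next
    fix \<phi> \<psi> assume a: "\<phi> \<in> carrier (free_module R X)" "\<psi> \<in> carrier (free_module R X)"
    let ?S = "?s \<phi> \<union> ?s \<psi>"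
    have S: "finite ?S" "?S \<subseteq> X" using supp a by blast+
    have c: "\<phi> \<oplus>\<^bsub>free_module R X\<^esub> \<psi> \<in> carrier (free_module R X)" using a by simp
    have e: "(\<phi> \<oplus>\<^bsub>free_module R X\<^esub> \<psi>) x = \<phi> x \<oplus>\<^bsub>R\<^esub> \<psi> x" for x by (simp add: free_module_def)
    have "free_eval R P b (\<phi> \<oplus>\<^bsub>free_module R X\<^esub> \<psi>)
        = (\<Oplus>\<^bsub>P\<^esub>p\<in>?S. (\<phi> \<oplus>\<^bsub>free_module R X\<^esub> \<psi>) p \<odot>\<^bsub>P\<^esub> b p)"
      by (rule free_eval_superset[OF assms c S(1) _ S(2)]) (auto simp: e)
    also have "\<dots> = (\<Oplus>\<^bsub>P\<^esub>p\<in>?S. \<phi> p \<odot>\<^bsub>P\<^esub> b p \<oplus>\<^bsub>P\<^esub> \<psi> p \<odot>\<^bsub>P\<^esub> b p)"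
      by (rule P.M.finsum_cong') (use S a in \<open>auto simp: e P.smult_l_distr val bX subset_iff\<close>)
    also have "\<dots> = (\<Oplus>\<^bsub>P\<^esub>p\<in>?S. \<phi> p \<odot>\<^bsub>P\<^esub> b p) \<oplus>\<^bsub>P\<^esub> (\<Oplus>\<^bsub>P\<^esub>p\<in>?S. \<psi> p \<odot>\<^bsub>P\<^esub> b p)"
      by (rule P.M.finsum_addf) (use S a in \<open>auto simp: val bX subset_iff\<close>)
    finally show "free_eval R P b (\<phi> \<oplus>\<^bsub>free_module R X\<^esub> \<psi>) = free_eval R P b \<phi> \<oplus>\<^bsub>P\<^esub> free_eval R P b \<psi>"
      using free_eval_superset[OF assms a(1) S(1) _ S(2)] free_eval_superset[OF assms a(2) S(1) _ S(2)]
      by auto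
  next
    fix a \<phi> assume a: "a \<in> carrier R" "\<phi> \<in> carrier (free_module R X)"
    have S: "finite (?s \<phi>)" "?s \<phi> \<subseteq> X" using supp[OF a(2)] by auto
    have c: "a \<odot>\<^bsub>free_module R X\<^esub> \<phi> \<in> carrier (free_module R X)" using a by simp
    have e: "(a \<odot>\<^bsub>free_module R X\<^esub> \<phi>) x = a \<otimes>\<^bsub>R\<^esub> \<phi> x" for x by (simp add: free_module_def)
    have "free_eval R P b (a \<odot>\<^bsub>free_module R X\<^esub> \<phi>)
        = (\<Oplus>\<^bsub>P\<^esub>p\<in>?s \<phi>. (a \<odot>\<^bsub>free_module R X\<^esub> \<phi>) p \<odot>\<^bsub>P\<^esub> b p)"
      by (rule free_eval_superset[OF assms c S(1) _ S(2)]) (use a in \<open>auto simp: e\<close>)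
    also have "\<dots> = (\<Oplus>\<^bsub>P\<^esub>p\<in>?s \<phi>. a \<odot>\<^bsub>P\<^esub> (\<phi> p \<odot>\<^bsub>P\<^esub> b p))"
      by (rule P.M.finsum_cong') (use S a in \<open>auto simp: e P.smult_assoc1 val bX subset_iff\<close>)
    also have "\<dots> = a \<odot>\<^bsub>P\<^esub> (\<Oplus>\<^bsub>P\<^esub>p\<in>?s \<phi>. \<phi> p \<odot>\<^bsub>P\<^esub> b p)"
      by (rule P.finsum_smult_ldistr[symmetric]) (use S a in \<open>auto simp: val bX subset_iff\<close>)
    finally show "free_eval R P b (a \<odot>\<^bsub>free_module R X\<^esub> \<phi>) = a \<odot>\<^bsub>P\<^esub> free_eval R P b \<phi>"
      by (simp add: free_eval_def)
  qed
qed

lemma free_eval_gen: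
  assumes "module R P" "b x \<in> carrier P" "\<one>\<^bsub>R\<^esub> \<noteq> \<zero>\<^bsub>R\<^esub>"
  shows "free_eval R P b (free_gen R x) = b x"
proof -
  interpret P: module R P by fact
  have "{y. free_gen R x y \<noteq> \<zero>\<^bsub>R\<^esub>} = {x}" using assms(3) by (auto simp: free_gen_def)
  then show ?thesis using assms(2)
    by (simp add: free_eval_def P.M.finsum_insert) (simp add: free_gen_def)
qed

lemma linear_map_free_eval:
  assumes "module R M" "module R P" "h \<in> linear_maps R M P" "b \<in> X \<rightarrow> carrier M"
    and "\<phi> \<in> carrier (free_module R X)"
  shows "h (free_eval R M b \<phi>) = free_eval R P (\<lambda>x. h (b x)) \<phi>"
proof -
  interpret M: module R M by fact
  interpret P: module R P by fact
  have "h (\<Oplus>\<^bsub>M\<^esub>p\<in>S. \<phi> p \<odot>\<^bsub>M\<^esub> b p) = (\<Oplus>\<^bsub>P\<^esub>p\<in>S. \<phi> p \<odot>\<^bsub>P\<^esub> h (b p))" if "finite S" "S \<subseteq> X" for S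
    using that
  proof (induction S rule: finite_induct)
    case empty
    then show ?case using linear_maps_zero[OF assms(1-3)] by simp
  next
    case (insert x S)
    have c: "\<phi> p \<in> carrier R" "b p \<in> carrier M" if "p \<in> X" for p
      using that assms by (auto simp: free_module_def)
    then have c': "h (b p) \<in> carrier P" if "p \<in> X" for p
      using that linear_maps_closed[OF assms(3)] by blast
    have i: "(\<lambda>p. \<phi> p \<odot>\<^bsub>M\<^esub> b p) \<in> S \<rightarrow> carrier M" "(\<lambda>p. \<phi> p \<odot>\<^bsub>P\<^esub> h (b p)) \<in> S \<rightarrow> carrier P"
      using insert.prems c c' by auto
    show ?case using insert i c c'
      by (simp add: linear_maps_add[OF assms(3)] linear_maps_smult[OF assms(3)] M.M.finsum_closed)
  qed
  moreover have "finite {x. \<phi> x \<noteq> \<zero>\<^bsub>R\<^esub>}" "{x. \<phi> x \<noteq> \<zero>\<^bsub>R\<^esub>} \<subseteq> X"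
    using assms(5) by (auto simp: free_module_def)
  ultimately show ?thesis by (simp add: free_eval_def)
qed

lemma free_eval_free_gen:
  assumes "cring R" "\<phi> \<in> carrier (free_module R X)"
  shows "free_eval R (free_module R X) (free_gen R) \<phi> = \<phi>"
proof
  fix y
  interpret cring R by fact
  interpret F: module R "free_module R X" by (rule free_module_module[OF assms(1)])
  have val: "\<phi> x \<in> carrier R" for x using assms by (cases "x \<in> X") (auto simp: free_module_def)
  have *: "(\<Oplus>\<^bsub>free_module R X\<^esub>p\<in>S. \<phi> p \<odot>\<^bsub>free_module R X\<^esub> free_gen R p) y = (if y \<in> S then \<phi> y else \<zero>\<^bsub>R\<^esub>)"
    if "finite S" "S \<subseteq> X" for S
    using that
  proof (induction S rule: finite_induct)
    case empty
    have "\<zero>\<^bsub>free_module R X\<^esub> y = \<zero>\<^bsub>R\<^esub>" by (simp add: free_module_def)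
    then show ?case by simp
  next
    case (insert x S)
    have i: "(\<lambda>p. \<phi> p \<odot>\<^bsub>free_module R X\<^esub> free_gen R p) \<in> S \<rightarrow> carrier (free_module R X)"
      using insert.prems by (intro Pi_I F.smult_closed val free_gen_closed[OF assms(1)]) auto
    have "\<phi> x \<odot>\<^bsub>free_module R X\<^esub> free_gen R x \<in> carrier (free_module R X)"
      using insert.prems val free_gen_closed[OF assms(1)] by (auto intro!: F.smult_closed)
    then have "(\<Oplus>\<^bsub>free_module R X\<^esub>p\<in>insert x S. \<phi> p \<odot>\<^bsub>free_module R X\<^esub> free_gen R p)
      = \<phi> x \<odot>\<^bsub>free_module R X\<^esub> free_gen R x \<oplus>\<^bsub>free_module R X\<^esub>
        (\<Oplus>\<^bsub>free_module R X\<^esub>p\<in>S. \<phi> p \<odot>\<^bsub>free_module R X\<^esub> free_gen R p)"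
      using insert.hyps i by (intro F.M.finsum_insert) auto
    moreover have "(\<phi> x \<odot>\<^bsub>free_module R X\<^esub> free_gen R x \<oplus>\<^bsub>free_module R X\<^esub> \<psi>) y
      = \<phi> x \<otimes>\<^bsub>R\<^esub> free_gen R x y \<oplus>\<^bsub>R\<^esub> \<psi> y" for \<psi> by (simp add: free_module_def)
    ultimately show ?case using insert val by (auto simp: free_gen_def)
  qed
  have "finite {x. \<phi> x \<noteq> \<zero>\<^bsub>R\<^esub>}" "{x. \<phi> x \<noteq> \<zero>\<^bsub>R\<^esub>} \<subseteq> X"
    using assms(2) by (auto simp: free_module_def)
  from *[OF this] show "free_eval R (free_module R X) (free_gen R) \<phi> y = \<phi> y"
    by (simp add: free_eval_def)
qed

context
  fixes R :: "('f, 'r) ring_scheme" and M :: "('f, 'a, 's) module_scheme"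
    and N :: "('f, 'b, 't) module_scheme"
  assumes R: "\<one>\<^bsub>R\<^esub> \<noteq> \<zero>\<^bsub>R\<^esub>" and M: "module R M" and N: "module R N"
begin

interpretation M: module R M by (rule M)
interpretation N: module R N by (rule N)

private abbreviation (input) "F \<equiv> free_module R (carrier M \<times> carrier N)"

interpretation F: module R F by (rule free_module_module[OF M.R.is_cring])

private lemma gen_closed: "x \<in> carrier M \<Longrightarrow> y \<in> carrier N \<Longrightarrow> free_gen R (x, y) \<in> carrier F"
  by (rule free_gen_closed[OF M.R.is_cring]) auto

private lemma tensor_carrier: "carrier (tensor R M N) = {tensor_null R M N +>\<^bsub>F\<^esub> \<phi> |\<phi>. \<phi> \<in> carrier F}"
  by (simp add: tensor_def carrier_quotient)

lemma coset_linear: "(\<lambda>\<phi>. tensor_null R M N +>\<^bsub>F\<^esub> \<phi>) \<in> linear_maps R F (tensor R M N)"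
  unfolding linear_maps_def
proof (intro CollectI conjI ballI)
  show "(\<lambda>\<phi>. tensor_null R M N +>\<^bsub>F\<^esub> \<phi>) \<in> carrier F \<rightarrow> carrier (tensor R M N)"
    by (auto simp: tensor_carrier)
qed (simp_all add: tensor_def add_rcoset[OF F.module_axioms tensor_null_submodule[OF M N]]
      smult_rcoset[OF F.module_axioms tensor_null_submodule[OF M N]])

lemma coset_null: 
  assumes "\<phi> \<in> tensor_null R M N"
  shows "tensor_null R M N +>\<^bsub>F\<^esub> \<phi> = \<zero>\<^bsub>tensor R M N\<^esub>"
proof -
  have s: "subgroup (tensor_null R M N) (add_monoid F)"
    using tensor_null_submodule[OF M N] by (simp add: submodule_def)
  then have "tensor_null R M N +>\<^bsub>F\<^esub> \<phi> = tensor_null R M N"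
    using assms subgroup.mem_carrier[OF s assms] by (intro F.M.a_coset_join2) auto
  then show ?thesis by (simp add: tensor_def quotient_module_def)
qed

lemma coset_eqI:
  assumes "\<phi> \<in> carrier F" "\<psi> \<in> carrier F" "\<phi> \<ominus>\<^bsub>F\<^esub> \<psi> \<in> tensor_null R M N"
  shows "tensor_null R M N +>\<^bsub>F\<^esub> \<phi> = tensor_null R M N +>\<^bsub>F\<^esub> \<psi>"
proof -
  interpret T: module R "tensor R M N" by (rule tensor_module[OF M N])
  have "(tensor_null R M N +>\<^bsub>F\<^esub> \<phi>) \<ominus>\<^bsub>tensor R M N\<^esub> (tensor_null R M N +>\<^bsub>F\<^esub> \<psi>) = \<zero>\<^bsub>tensor R M N\<^esub>"
    using coset_null[OF assms(3)] assms
    by (simp add: linear_maps_minus[OF F.module_axioms T.module_axioms coset_linear])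
  then show ?thesis
    using assms linear_maps_closed[OF coset_linear] by (simp add: module_diff_zero[OF T.module_axioms])
qed

lemma pure_tensor_bilinear: "pure_tensor R M N \<in> bilinear_maps R M N (tensor R M N)"
proof -
  have rel: "\<And>x x' y. x \<in> carrier M \<Longrightarrow> x' \<in> carrier M \<Longrightarrow> y \<in> carrier N \<Longrightarrow>
      free_gen R (x \<oplus>\<^bsub>M\<^esub> x', y) \<ominus>\<^bsub>F\<^esub> (free_gen R (x, y) \<oplus>\<^bsub>F\<^esub> free_gen R (x', y)) \<in> tensor_null R M N"
    "\<And>x y y'. x \<in> carrier M \<Longrightarrow> y \<in> carrier N \<Longrightarrow> y' \<in> carrier N \<Longrightarrow>
      free_gen R (x, y \<oplus>\<^bsub>N\<^esub> y') \<ominus>\<^bsub>F\<^esub> (free_gen R (x, y) \<oplus>\<^bsub>F\<^esub> free_gen R (x, y')) \<in> tensor_null R M N"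
    "\<And>a x y. a \<in> carrier R \<Longrightarrow> x \<in> carrier M \<Longrightarrow> y \<in> carrier N \<Longrightarrow>
      free_gen R (a \<odot>\<^bsub>M\<^esub> x, y) \<ominus>\<^bsub>F\<^esub> a \<odot>\<^bsub>F\<^esub> free_gen R (x, y) \<in> tensor_null R M N"
    "\<And>a x y. a \<in> carrier R \<Longrightarrow> x \<in> carrier M \<Longrightarrow> y \<in> carrier N \<Longrightarrow>
      free_gen R (x, a \<odot>\<^bsub>N\<^esub> y) \<ominus>\<^bsub>F\<^esub> a \<odot>\<^bsub>F\<^esub> free_gen R (x, y) \<in> tensor_null R M N"
    by (rule subsetD[OF bilinear_relations_null], unfold bilinear_relations_def Let_def, blast)+
  note eq = rel[THEN coset_eqI[rotated 2]]
  show ?thesis unfolding bilinear_maps_def linear_maps_def pure_tensor_def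
    by (auto simp: eq gen_closed linear_maps_closed[OF coset_linear]
        linear_maps_add[OF coset_linear, symmetric] linear_maps_smult[OF coset_linear, symmetric])
qed

context
  fixes P :: "('f, 'c, 'u) module_scheme" and b :: "'a \<Rightarrow> 'b \<Rightarrow> 'c"
  assumes P: "module R P" and b: "b \<in> bilinear_maps R M N P"
begin

interpretation P: module R P by (rule P)

private lemma b_closed: "x \<in> carrier M \<Longrightarrow> y \<in> carrier N \<Longrightarrow> b x y \<in> carrier P"
  using b unfolding bilinear_maps_def linear_maps_def by blast

private lemma b_Pi: "(\<lambda>p. b (fst p) (snd p)) \<in> carrier M \<times> carrier N \<rightarrow> carrier P"
  using b_closed by auto

private abbreviation (input) "ev \<equiv> free_eval R P (\<lambda>p. b (fst p) (snd p))"

private lemma ev_linear: "ev \<in> linear_maps R F P"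
  by (rule free_eval_linear[OF P b_Pi])

private lemma ev_gen: "x \<in> carrier M \<Longrightarrow> y \<in> carrier N \<Longrightarrow> ev (free_gen R (x, y)) = b x y"
  using b_closed R by (subst free_eval_gen[OF P]) auto

private lemma ev_null: "\<phi> \<in> tensor_null R M N \<Longrightarrow> ev \<phi> = \<zero>\<^bsub>P\<^esub>"
proof -
  let ?K = "{\<phi> \<in> carrier F. ev \<phi> = \<zero>\<^bsub>P\<^esub>}"
  have neg: "ev (\<ominus>\<^bsub>F\<^esub> \<phi>) = \<zero>\<^bsub>P\<^esub>" if "\<phi> \<in> carrier F" "ev \<phi> = \<zero>\<^bsub>P\<^esub>" for \<phi>
    using linear_maps_minus[OF F.module_axioms P ev_linear F.M.zero_closed that(1)] that
    by (simp add: a_minus_def linear_maps_zero[OF F.module_axioms P ev_linear])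
  have "submodule ?K R F"
    by (rule F.submoduleI)
      (auto simp: linear_maps_add[OF ev_linear] linear_maps_smult[OF ev_linear]
        linear_maps_zero[OF F.module_axioms P ev_linear] neg)
  moreover have "bilinear_relations R M N \<subseteq> ?K"
  proof -
    have [simp]: "b x y \<in> carrier P" if "x \<in> carrier M" "y \<in> carrier N" for x y
      using b_closed that by auto
    have bl:
      "x \<in> carrier M \<Longrightarrow> y \<in> carrier N \<Longrightarrow> y' \<in> carrier N \<Longrightarrow> b x (y \<oplus>\<^bsub>N\<^esub> y') = b x y \<oplus>\<^bsub>P\<^esub> b x y'"
      "x \<in> carrier M \<Longrightarrow> x' \<in> carrier M \<Longrightarrow> y \<in> carrier N \<Longrightarrow> b (x \<oplus>\<^bsub>M\<^esub> x') y = b x y \<oplus>\<^bsub>P\<^esub> b x' y"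
      "x \<in> carrier M \<Longrightarrow> y \<in> carrier N \<Longrightarrow> a \<in> carrier R \<Longrightarrow> b x (a \<odot>\<^bsub>N\<^esub> y) = a \<odot>\<^bsub>P\<^esub> b x y"
      "x \<in> carrier M \<Longrightarrow> y \<in> carrier N \<Longrightarrow> a \<in> carrier R \<Longrightarrow> b (a \<odot>\<^bsub>M\<^esub> x) y = a \<odot>\<^bsub>P\<^esub> b x y"
      for x x' y y' a
      using b by (auto simp: bilinear_maps_def linear_maps_def)
    have "\<phi> \<in> ?K" if r: "\<phi> \<in> bilinear_relations R M N" for \<phi>
    proof
      have "\<phi> \<in> carrier F" using bilinear_relations_closed[OF M N] r by auto
      moreover have "ev \<phi> = \<zero>\<^bsub>P\<^esub>"
        using r unfolding bilinear_relations_def Let_def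
        by (auto simp: linear_maps_minus[OF F.module_axioms P ev_linear] gen_closed ev_gen bl
            linear_maps_add[OF ev_linear] linear_maps_smult[OF ev_linear] module_diff_zero[OF P.module_axioms])
      ultimately show "\<phi> \<in> carrier F \<and> ev \<phi> = \<zero>\<^bsub>P\<^esub>" by simp
    qed
    then show ?thesis by blast
  qed
  ultimately have "tensor_null R M N \<subseteq> ?K" unfolding tensor_null_def by blast
  then show "\<phi> \<in> tensor_null R M N \<Longrightarrow> ev \<phi> = \<zero>\<^bsub>P\<^esub>" by blast
qed

lemma tensor_lift_coset:
  assumes "\<phi> \<in> carrier F"
  shows "tensor_lift R P b (tensor_null R M N +>\<^bsub>F\<^esub> \<phi>) = ev \<phi>"
proof -
  let ?A = "tensor_null R M N +>\<^bsub>F\<^esub> \<phi>"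
  have *: "ev \<psi> = ev \<phi>" if \<psi>: "\<psi> \<in> ?A" for \<psi>
  proof -
    obtain h where h: "h \<in> tensor_null R M N" "\<psi> = h \<oplus>\<^bsub>F\<^esub> \<phi>" using \<psi> unfolding a_r_coset_def' by blast
    have "h \<in> carrier F" using h tensor_null_submodule[OF M N] by (auto dest: F.submoduleE)
    then show ?thesis
      using h assms ev_null linear_maps_closed[OF ev_linear assms] by (simp add: linear_maps_add[OF ev_linear])
  qed
  have "\<zero>\<^bsub>F\<^esub> \<in> tensor_null R M N"
    using tensor_null_submodule[OF M N] by (auto simp: submodule_def dest: subgroup.one_closed)
  then have "\<zero>\<^bsub>F\<^esub> \<oplus>\<^bsub>F\<^esub> \<phi> \<in> ?A" by (auto simp: a_r_coset_def')
  then have "(SOME \<psi>. \<psi> \<in> ?A) \<in> ?A" by (rule someI[of "\<lambda>\<psi>. \<psi> \<in> ?A"])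
  then show ?thesis unfolding tensor_lift_def by (rule *)
qed

lemma tensor_lift_linear: "tensor_lift R P b \<in> linear_maps R (tensor R M N) P"
  unfolding linear_maps_def
proof (intro CollectI conjI ballI)
  note cl = linear_maps_add[OF coset_linear, symmetric] linear_maps_smult[OF coset_linear, symmetric]
  show "tensor_lift R P b \<in> carrier (tensor R M N) \<rightarrow> carrier P"
    by (auto simp: tensor_carrier tensor_lift_coset linear_maps_closed[OF ev_linear])
  fix A B assume "A \<in> carrier (tensor R M N)" "B \<in> carrier (tensor R M N)"
  then show "tensor_lift R P b (A \<oplus>\<^bsub>tensor R M N\<^esub> B) = tensor_lift R P b A \<oplus>\<^bsub>P\<^esub> tensor_lift R P b B"
    by (auto simp: tensor_carrier cl tensor_lift_coset linear_maps_add[OF ev_linear])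
next
  note cl = linear_maps_add[OF coset_linear, symmetric] linear_maps_smult[OF coset_linear, symmetric]
  fix a A assume "a \<in> carrier R" "A \<in> carrier (tensor R M N)"
  then show "tensor_lift R P b (a \<odot>\<^bsub>tensor R M N\<^esub> A) = a \<odot>\<^bsub>P\<^esub> tensor_lift R P b A"
    by (auto simp: tensor_carrier cl tensor_lift_coset linear_maps_smult[OF ev_linear])
qed

lemma tensor_lift_pure:
  "x \<in> carrier M \<Longrightarrow> y \<in> carrier N \<Longrightarrow> tensor_lift R P b (pure_tensor R M N x y) = b x y"
  by (simp add: pure_tensor_def tensor_lift_coset gen_closed ev_gen)

lemma tensor_lift_unique:
  assumes "h \<in> linear_maps R (tensor R M N) P"
    and "\<And>x y. x \<in> carrier M \<Longrightarrow> y \<in> carrier N \<Longrightarrow> h (pure_tensor R M N x y) = b x y"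
    and "A \<in> carrier (tensor R M N)"
  shows "h A = tensor_lift R P b A"
proof -
  obtain \<phi> where \<phi>: "\<phi> \<in> carrier F" "A = tensor_null R M N +>\<^bsub>F\<^esub> \<phi>"
    using assms(3) by (auto simp: tensor_carrier)
  let ?h = "\<lambda>\<phi>. h (tensor_null R M N +>\<^bsub>F\<^esub> \<phi>)"
  have l: "?h \<in> linear_maps R F P"
    using assms(1) coset_linear by (auto simp: linear_maps_def Pi_iff)
  have "?h \<phi> = ?h (free_eval R F (free_gen R) \<phi>)"
    by (simp add: free_eval_free_gen[OF M.R.is_cring \<phi>(1)])
  also have "\<dots> = free_eval R P (\<lambda>p. ?h (free_gen R p)) \<phi>"
    by (rule linear_map_free_eval[OF F.module_axioms P l _ \<phi>(1)]) (auto simp: gen_closed)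
  also have "\<dots> = ev \<phi>"
    unfolding free_eval_def
  proof (rule P.M.finsum_cong')
    have s: "p \<in> carrier M \<times> carrier N \<and> \<phi> p \<in> carrier R" if "\<phi> p \<noteq> \<zero>\<^bsub>R\<^esub>" for p
    proof -
      have "p \<in> carrier M \<times> carrier N"
        using \<phi>(1) that unfolding free_module_def by (cases p) auto
      then show ?thesis using \<phi>(1) by (auto simp: free_module_def)
    qed
    show "(\<lambda>p. \<phi> p \<odot>\<^bsub>P\<^esub> b (fst p) (snd p)) \<in> {p. \<phi> p \<noteq> \<zero>\<^bsub>R\<^esub>} \<rightarrow> carrier P"
      using s b_closed by fastforce
    fix p assume "p \<in> {p. \<phi> p \<noteq> \<zero>\<^bsub>R\<^esub>}"
    with s[of p] show "\<phi> p \<odot>\<^bsub>P\<^esub> ?h (free_gen R p) = \<phi> p \<odot>\<^bsub>P\<^esub> b (fst p) (snd p)"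
      using assms(2)[of "fst p" "snd p"] b_closed by (auto simp: pure_tensor_def)
  qed simp
  finally show ?thesis by (simp add: \<phi> tensor_lift_coset)
qed

end

end


lemma linear_comp_bilinear:
  assumes "b \<in> bilinear_maps R M' N' P" "f \<in> linear_maps R M M'" "g \<in> linear_maps R N N'"
  shows "(\<lambda>x y. b (f x) (g y)) \<in> bilinear_maps R M N P"
  using assms by (auto simp: bilinear_maps_def linear_maps_def Pi_iff)

lemma tensor_map_linear:
  assumes "\<one>\<^bsub>R\<^esub> \<noteq> \<zero>\<^bsub>R\<^esub>" "module R M" "module R N" "module R P" "module R Q"
    and "f \<in> linear_maps R M P" "g \<in> linear_maps R N Q"
  shows "tensor_map R P Q f g \<in> linear_maps R (tensor R M N) (tensor R P Q)"
    and "x \<in> carrier M \<Longrightarrow> y \<in> carrier N \<Longrightarrow>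
      tensor_map R P Q f g (pure_tensor R M N x y) = pure_tensor R P Q (f x) (g y)"
  using tensor_lift_linear[OF assms(1-3) tensor_module[OF assms(4,5)]]
    tensor_lift_pure[OF assms(1-3) tensor_module[OF assms(4,5)]]
    linear_comp_bilinear[OF pure_tensor_bilinear[OF assms(1,4,5)] assms(6,7)]
  by (auto simp: tensor_map_def)

lemma tensor_swap_linear:
  assumes "\<one>\<^bsub>R\<^esub> \<noteq> \<zero>\<^bsub>R\<^esub>" "module R L"
  shows "tensor_swap R L \<in> linear_maps R (tensor R L L) (tensor R L L)"
    and "x \<in> carrier L \<Longrightarrow> y \<in> carrier L \<Longrightarrow>
      tensor_swap R L (pure_tensor R L L x y) = pure_tensor R L L y x"
proof -
  have "(\<lambda>x y. pure_tensor R L L y x) \<in> bilinear_maps R L L (tensor R L L)"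
    using pure_tensor_bilinear[OF assms(1,2,2)] by (auto simp: bilinear_maps_def)
  then show "tensor_swap R L \<in> linear_maps R (tensor R L L) (tensor R L L)"
    "x \<in> carrier L \<Longrightarrow> y \<in> carrier L \<Longrightarrow>
      tensor_swap R L (pure_tensor R L L x y) = pure_tensor R L L y x"
    using tensor_lift_linear[OF assms(1,2,2) tensor_module[OF assms(2,2)]]
      tensor_lift_pure[OF assms(1,2,2) tensor_module[OF assms(2,2)]]
    by (auto simp: tensor_swap_def)
qed

lemma tensor_lift_bilinear:
  assumes "\<one>\<^bsub>R\<^esub> \<noteq> \<zero>\<^bsub>R\<^esub>" "module R K" "module R M" "module R N" "module R P"
    and "\<And>k. k \<in> carrier K \<Longrightarrow> c k \<in> bilinear_maps R M N P"
    and "\<And>x y. x \<in> carrier M \<Longrightarrow> y \<in> carrier N \<Longrightarrow> (\<lambda>k. c k x y) \<in> linear_maps R K P"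
  shows "(\<lambda>k. tensor_lift R P (c k)) \<in> bilinear_maps R K (tensor R M N) P"
proof -
  interpret K: module R K by fact
  interpret P: module R P by fact
  interpret T: module R "tensor R M N" by (rule tensor_module[OF assms(3,4)])
  note lin = tensor_lift_linear[OF assms(1,3,4,5,6)]
    and pure = tensor_lift_pure[OF assms(1,3,4,5,6)]
  have add: "tensor_lift R P (c (k \<oplus>\<^bsub>K\<^esub> k')) A = tensor_lift R P (c k) A \<oplus>\<^bsub>P\<^esub> tensor_lift R P (c k') A"
    if k: "k \<in> carrier K" "k' \<in> carrier K" and A: "A \<in> carrier (tensor R M N)" for k k' A
  proof (rule tensor_lift_unique[OF assms(1,3,4,5) assms(6), symmetric])
    show "(\<lambda>A. tensor_lift R P (c k) A \<oplus>\<^bsub>P\<^esub> tensor_lift R P (c k') A) \<in> linear_maps R (tensor R M N) P"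
      using lin[OF k(1)] lin[OF k(2)] 
      by (auto simp: linear_maps_def Pi_iff P.smult_r_distr P.M.a_ac)
  qed (use k A assms(7) in \<open>auto simp: pure linear_maps_def\<close>)
  have smult: "tensor_lift R P (c (a \<odot>\<^bsub>K\<^esub> k)) A = a \<odot>\<^bsub>P\<^esub> tensor_lift R P (c k) A"
    if k: "k \<in> carrier K" "a \<in> carrier R" and A: "A \<in> carrier (tensor R M N)" for k a A
  proof (rule tensor_lift_unique[OF assms(1,3,4,5) assms(6), symmetric])
    show "(\<lambda>A. a \<odot>\<^bsub>P\<^esub> tensor_lift R P (c k) A) \<in> linear_maps R (tensor R M N) P"
      using lin[OF k(1)] k(2)
      by (auto simp: linear_maps_def Pi_iff P.smult_r_distr P.smult_assoc1[symmetric] K.R.m_comm)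
  qed (use k A assms(7) in \<open>auto simp: pure linear_maps_def\<close>)
  have "(\<lambda>k. tensor_lift R P (c k) A) \<in> linear_maps R K P" if A: "A \<in> carrier (tensor R M N)" for A
    unfolding linear_maps_def using add[OF _ _ A] smult[OF _ _ A] lin[THEN linear_maps_closed, OF _ A] by auto
  then show ?thesis using lin by (auto simp: bilinear_maps_def)
qed

lemma bilinear_swap: "b \<in> bilinear_maps R M N P \<Longrightarrow> (\<lambda>y x. b x y) \<in> bilinear_maps R N M P"
  by (auto simp: bilinear_maps_def)

lemma pure_tensor_triple:
  assumes "\<one>\<^bsub>R\<^esub> \<noteq> \<zero>\<^bsub>R\<^esub>" "module R M" "module R N" "module R P"
  defines "T \<equiv> tensor R (tensor R M N) P"
    and "t \<equiv> \<lambda>x y z. pure_tensor R (tensor R M N) P (pure_tensor R M N x y) z"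
  shows "x \<in> carrier M \<Longrightarrow> y \<in> carrier N \<Longrightarrow> t x y \<in> linear_maps R P T"
    and "x \<in> carrier M \<Longrightarrow> z \<in> carrier P \<Longrightarrow> (\<lambda>y. t x y z) \<in> linear_maps R N T"
    and "y \<in> carrier N \<Longrightarrow> z \<in> carrier P \<Longrightarrow> (\<lambda>x. t x y z) \<in> linear_maps R M T"
  using pure_tensor_bilinear[OF assms(1) tensor_module[OF assms(2,3)] assms(4)]
    pure_tensor_bilinear[OF assms(1,2,3)]
  unfolding T_def t_def bilinear_maps_def linear_maps_def Pi_iff by auto

lemma tensor_assoc_linear:
  assumes "\<one>\<^bsub>R\<^esub> \<noteq> \<zero>\<^bsub>R\<^esub>" "module R M" "module R N" "module R P"
  shows "tensor_assoc R M N P \<in> linear_maps R (tensor R M (tensor R N P)) (tensor R (tensor R M N) P)"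
    and "x \<in> carrier M \<Longrightarrow> y \<in> carrier N \<Longrightarrow> z \<in> carrier P \<Longrightarrow>
      tensor_assoc R M N P (pure_tensor R M (tensor R N P) x (pure_tensor R N P y z)) =
      pure_tensor R (tensor R M N) P (pure_tensor R M N x y) z"
proof -
  let ?T = "tensor R (tensor R M N) P"
  let ?t = "\<lambda>x y z. pure_tensor R (tensor R M N) P (pure_tensor R M N x y) z"
  note tri = pure_tensor_triple[OF assms]
  note NP = tensor_module[OF assms(3,4)] and T = tensor_module[OF tensor_module[OF assms(2,3)] assms(4)]
  have bl: "?t x \<in> bilinear_maps R N P ?T" if "x \<in> carrier M" for x
    using tri that by (auto simp: bilinear_maps_def)
  have BL: "(\<lambda>x. tensor_lift R ?T (?t x)) \<in> bilinear_maps R M (tensor R N P) ?T"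
    by (rule tensor_lift_bilinear[OF assms T bl]) (use tri in auto)
  have pc: "pure_tensor R N P y z \<in> carrier (tensor R N P)" if "y \<in> carrier N" "z \<in> carrier P" for y z
    using pure_tensor_bilinear[OF assms(1,3,4)] that by (auto simp: bilinear_maps_def linear_maps_def Pi_iff)
  show "tensor_assoc R M N P \<in> linear_maps R (tensor R M (tensor R N P)) ?T"
    using tensor_lift_linear[OF assms(1,2) NP T BL] by (simp add: tensor_assoc_def Let_def)
  show "x \<in> carrier M \<Longrightarrow> y \<in> carrier N \<Longrightarrow> z \<in> carrier P \<Longrightarrow>
      tensor_assoc R M N P (pure_tensor R M (tensor R N P) x (pure_tensor R N P y z)) = ?t x y z"
    using tensor_lift_pure[OF assms(1,2) NP T BL] tensor_lift_pure[OF assms(1,3,4) T bl] pc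
    by (simp add: tensor_assoc_def Let_def)
qed

lemma tensor_cycle_linear:
  assumes "\<one>\<^bsub>R\<^esub> \<noteq> \<zero>\<^bsub>R\<^esub>" "module R L"
  shows "tensor_cycle R L \<in> linear_maps R (tensor R (tensor R L L) L) (tensor R (tensor R L L) L)"
    and "x \<in> carrier L \<Longrightarrow> y \<in> carrier L \<Longrightarrow> z \<in> carrier L \<Longrightarrow>
      tensor_cycle R L (pure_tensor R (tensor R L L) L (pure_tensor R L L x y) z) =
      pure_tensor R (tensor R L L) L (pure_tensor R L L y z) x"
proof -
  let ?T = "tensor R (tensor R L L) L"
  let ?t = "\<lambda>z x y. pure_tensor R (tensor R L L) L (pure_tensor R L L y z) x"
  note tri = pure_tensor_triple[OF assms(1,2,2,2)]
  note LL = tensor_module[OF assms(2,2)] and T = tensor_module[OF tensor_module[OF assms(2,2)] assms(2)]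
  have bl: "?t z \<in> bilinear_maps R L L ?T" if "z \<in> carrier L" for z
    using tri that by (auto simp: bilinear_maps_def)
  have "(\<lambda>z. tensor_lift R ?T (?t z)) \<in> bilinear_maps R L (tensor R L L) ?T"
    by (rule tensor_lift_bilinear[OF assms(1,2,2,2) T bl]) (use tri in auto)
  note BL = bilinear_swap[OF this]
  have pc: "pure_tensor R L L y z \<in> carrier (tensor R L L)" if "y \<in> carrier L" "z \<in> carrier L" for y z
    using pure_tensor_bilinear[OF assms(1,2,2)] that by (auto simp: bilinear_maps_def linear_maps_def Pi_iff)
  show "tensor_cycle R L \<in> linear_maps R ?T ?T"
    using tensor_lift_linear[OF assms(1) LL assms(2) T BL] by (simp add: tensor_cycle_def Let_def)
  show "x \<in> carrier L \<Longrightarrow> y \<in> carrier L \<Longrightarrow> z \<in> carrier L \<Longrightarrow>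
      tensor_cycle R L (pure_tensor R (tensor R L L) L (pure_tensor R L L x y) z) =
      pure_tensor R (tensor R L L) L (pure_tensor R L L y z) x"
    using tensor_lift_pure[OF assms(1) LL assms(2) T BL] tensor_lift_pure[OF assms(1,2,2) T bl] pc
    by (simp add: tensor_cycle_def Let_def)
qed

end

theory Submission
  imports Defs
begin

text \<open>
  With \<open>a = \<alpha> ^^ n\<close> and \<open>A = a \<otimes> id\<close>, both sides of each comodule identity for \<open>A \<circ> \<delta>\<close>, \<open>A \<circ> \<beta>\<close> are
  the images of those for \<open>\<delta>\<close>, \<open>\<beta>\<close> under \<open>Q = (a \<otimes> a) \<otimes> id\<close>. Indeed
  \<open>(\<kappa> \<otimes> \<alpha>\<^sub>M) \<circ> A = Q \<circ> (\<kappa> \<otimes> \<alpha>\<^sub>M)\<close> for \<open>\<kappa> = \<gamma>, \<Delta>\<close>, because \<open>\<kappa> \<circ> a = (a \<otimes> a) \<circ> \<kappa>\<close>;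
  \<open>(\<alpha> \<otimes> A \<circ> \<epsilon>) \<circ> A = (a \<otimes> A) \<circ> (\<alpha> \<otimes> \<epsilon>)\<close> for \<open>\<epsilon> = \<delta>, \<beta>\<close>, where \<open>a \<otimes> A\<close> corresponds to \<open>Q\<close>
  under the associator; and \<open>Q\<close> commutes with \<open>\<tau> \<otimes> id\<close>.
\<close>

lemma linear_maps_comp:
  "f \<in> linear_maps R M N \<Longrightarrow> g \<in> linear_maps R N P \<Longrightarrow> (\<lambda>x. g (f x)) \<in> linear_maps R M P"
  by (auto simp: linear_maps_def Pi_iff)

lemma linear_maps_id: "id \<in> linear_maps R M M"
  by (auto simp: linear_maps_def)

lemma linear_maps_funpow: "f \<in> linear_maps R M M \<Longrightarrow> f ^^ n \<in> linear_maps R M M"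
  by (induction n) (auto simp: linear_maps_def Pi_iff)

lemma pure_tensor_closed:
  assumes "\<one>\<^bsub>R\<^esub> \<noteq> \<zero>\<^bsub>R\<^esub>" "module R M" "module R N" "x \<in> carrier M" "y \<in> carrier N"
  shows "pure_tensor R M N x y \<in> carrier (tensor R M N)"
  using pure_tensor_bilinear[OF assms(1-3)] assms(4,5)
  by (auto simp: bilinear_maps_def linear_maps_def Pi_iff)

text \<open>Both maps are lifts of the same bilinear map, \<open>g\<close> evaluated at pure
  tensors, so uniqueness in the universal property identifies them.\<close>

lemma linear_maps_tensor_eqI:
  assumes "\<one>\<^bsub>R\<^esub> \<noteq> \<zero>\<^bsub>R\<^esub>" "module R M" "module R N" "module R P"
    and f: "f \<in> linear_maps R (tensor R M N) P" and g: "g \<in> linear_maps R (tensor R M N) P"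
    and eq: "\<And>x y. x \<in> carrier M \<Longrightarrow> y \<in> carrier N \<Longrightarrow>
      f (pure_tensor R M N x y) = g (pure_tensor R M N x y)"
    and t: "t \<in> carrier (tensor R M N)"
  shows "f t = g t"
proof -
  have b: "(\<lambda>x y. g (pure_tensor R M N x y)) \<in> bilinear_maps R M N P"
    using pure_tensor_bilinear[OF assms(1-3)] g
    by (auto simp: bilinear_maps_def intro: linear_maps_comp)
  show ?thesis
    using tensor_lift_unique[OF assms(1-4) b f eq t] tensor_lift_unique[OF assms(1-4) b g refl t]
    by simp
qed

text \<open>For fixed \<open>x\<close> the map s \<mapsto> x \<otimes> s is linear on N \<otimes> P,
  so the twofold criterion applies first to the inner product and then to the outer one.\<close>

lemma linear_maps_tensor3_eqI:
  assumes "\<one>\<^bsub>R\<^esub> \<noteq> \<zero>\<^bsub>R\<^esub>" "module R M" "module R N" "module R P" "module R Q"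
    and f: "f \<in> linear_maps R (tensor R M (tensor R N P)) Q"
    and g: "g \<in> linear_maps R (tensor R M (tensor R N P)) Q"
    and eq: "\<And>x y z. x \<in> carrier M \<Longrightarrow> y \<in> carrier N \<Longrightarrow> z \<in> carrier P \<Longrightarrow>
      f (pure_tensor R M (tensor R N P) x (pure_tensor R N P y z)) =
      g (pure_tensor R M (tensor R N P) x (pure_tensor R N P y z))"
    and t: "t \<in> carrier (tensor R M (tensor R N P))"
  shows "f t = g t"
proof (rule linear_maps_tensor_eqI[OF assms(1,2) tensor_module[OF assms(3,4)] assms(5) f g _ t])
  fix x s assume x: "x \<in> carrier M" and s: "s \<in> carrier (tensor R N P)"
  have p: "pure_tensor R M (tensor R N P) x
      \<in> linear_maps R (tensor R N P) (tensor R M (tensor R N P))"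
    using pure_tensor_bilinear[OF assms(1,2) tensor_module[OF assms(3,4)]] x
    by (auto simp: bilinear_maps_def)
  show "f (pure_tensor R M (tensor R N P) x s) = g (pure_tensor R M (tensor R N P) x s)"
    by (rule linear_maps_tensor_eqI[OF assms(1,3-5) linear_maps_comp[OF p f]
        linear_maps_comp[OF p g] eq[OF x] s])
qed

text \<open>Functoriality of the tensor product, checked on pure tensors. The composites enter as
  separate maps \<open>h\<close> and \<open>k\<close>, tied to \<open>f'\<close>, \<open>f\<close>
  and \<open>g'\<close>, \<open>g\<close> on the carriers only, since the naturality identities used
  later hold only there.\<close>

lemma tensor_map_comp:
  assumes "\<one>\<^bsub>R\<^esub> \<noteq> \<zero>\<^bsub>R\<^esub>" "module R M" "module R N" "module R M'" "module R N'"
    "module R M''" "module R N''"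
    and f: "f \<in> linear_maps R M M'" and g: "g \<in> linear_maps R N N'"
    and f': "f' \<in> linear_maps R M' M''" and g': "g' \<in> linear_maps R N' N''"
    and h: "h \<in> linear_maps R M M''" and k: "k \<in> linear_maps R N N''"
    and fh: "\<And>x. x \<in> carrier M \<Longrightarrow> f' (f x) = h x"
    and gk: "\<And>y. y \<in> carrier N \<Longrightarrow> g' (g y) = k y"
    and t: "t \<in> carrier (tensor R M N)"
  shows "tensor_map R M'' N'' f' g' (tensor_map R M' N' f g t) = tensor_map R M'' N'' h k t"
proof (rule linear_maps_tensor_eqI[OF assms(1-3) tensor_module[OF assms(6,7)] _ _ _ t])
  note fg = tensor_map_linear[OF assms(1-5) f g]
    and fg' = tensor_map_linear[OF assms(1,4-7) f' g']
    and hk = tensor_map_linear[OF assms(1-3,6,7) h k]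
  show "(\<lambda>t. tensor_map R M'' N'' f' g' (tensor_map R M' N' f g t))
      \<in> linear_maps R (tensor R M N) (tensor R M'' N'')"
    by (rule linear_maps_comp[OF fg(1) fg'(1)])
  show "tensor_map R M'' N'' h k \<in> linear_maps R (tensor R M N) (tensor R M'' N'')"
    by (rule hk(1))
  fix x y assume "x \<in> carrier M" "y \<in> carrier N"
  moreover from this have "f x \<in> carrier M'" "g y \<in> carrier N'"
    using f g by (auto simp: linear_maps_def)
  ultimately show "tensor_map R M'' N'' f' g' (tensor_map R M' N' f g (pure_tensor R M N x y)) =
      tensor_map R M'' N'' h k (pure_tensor R M N x y)"
    by (simp add: fg(2) fg'(2) hk(2) fh gk)
qed

text \<open>The tensor product of two commuting squares commutes: both ways around equal the tensor
  map of the composites of \<open>h'\<close> with \<open>h\<close> and of \<open>k'\<close> with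
  \<open>k\<close>. Most of the intertwining relations in the main proof are instances.\<close>

lemma tensor_map_comm:
  assumes "\<one>\<^bsub>R\<^esub> \<noteq> \<zero>\<^bsub>R\<^esub>" "module R M" "module R N" "module R M'" "module R N'"
    "module R K" "module R K'" "module R M''" "module R N''"
    and "f \<in> linear_maps R M M'" "g \<in> linear_maps R N N'"
    and "f' \<in> linear_maps R M' M''" "g' \<in> linear_maps R N' N''"
    and "h \<in> linear_maps R M K" "k \<in> linear_maps R N K'"
    and "h' \<in> linear_maps R K M''" "k' \<in> linear_maps R K' N''"
    and "\<And>x. x \<in> carrier M \<Longrightarrow> f' (f x) = h' (h x)"
    and "\<And>y. y \<in> carrier N \<Longrightarrow> g' (g y) = k' (k y)"
    and "t \<in> carrier (tensor R M N)"
  shows "tensor_map R M'' N'' f' g' (tensor_map R M' N' f g t) =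
    tensor_map R M'' N'' h' k' (tensor_map R K K' h k t)"
  using tensor_map_comp[OF assms(1-5,8-9) assms(10-13) linear_maps_comp[OF assms(14,16)]
      linear_maps_comp[OF assms(15,17)] assms(18-20)]
    tensor_map_comp[OF assms(1-3,6-9) assms(14-17) linear_maps_comp[OF assms(14,16)]
      linear_maps_comp[OF assms(15,17)] refl refl assms(20)]
  by simp

text \<open>Both sides send x \<otimes> (y \<otimes> z) to (f x \<otimes> g y) \<otimes> h z. This
  is what turns a \<otimes> A into \<open>Q\<close>.\<close>

lemma tensor_assoc_natural:
  assumes "\<one>\<^bsub>R\<^esub> \<noteq> \<zero>\<^bsub>R\<^esub>" "module R M" "module R N" "module R P"
    "module R M'" "module R N'" "module R P'"
    and f: "f \<in> linear_maps R M M'" and g: "g \<in> linear_maps R N N'" and h: "h \<in> linear_maps R P P'"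
    and t: "t \<in> carrier (tensor R M (tensor R N P))"
  shows "tensor_assoc R M' N' P' (tensor_map R M' (tensor R N' P') f (tensor_map R N' P' g h) t) =
    tensor_map R (tensor R M' N') P' (tensor_map R M' N' f g) h (tensor_assoc R M N P t)"
proof -
  note MN = tensor_module[OF assms(2,3)] and NP = tensor_module[OF assms(3,4)]
    and MN' = tensor_module[OF assms(5,6)] and NP' = tensor_module[OF assms(6,7)]
  note fg = tensor_map_linear[OF assms(1,2,3,5,6) f g]
    and gh = tensor_map_linear[OF assms(1,3,4,6,7) g h]
  note f_gh = tensor_map_linear[OF assms(1,2) NP assms(5) NP' f gh(1)]
    and fg_h = tensor_map_linear[OF assms(1) MN assms(4) MN' assms(7) fg(1) h]
    and as = tensor_assoc_linear[OF assms(1-4)] and as' = tensor_assoc_linear[OF assms(1,5-7)]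
  show ?thesis
  proof (rule linear_maps_tensor3_eqI[OF assms(1-4) tensor_module[OF MN' assms(7)]
        linear_maps_comp[OF f_gh(1) as'(1)] linear_maps_comp[OF as(1) fg_h(1)] _ t])
    fix x y z assume "x \<in> carrier M" "y \<in> carrier N" "z \<in> carrier P"
    moreover from this have "f x \<in> carrier M'" "g y \<in> carrier N'" "h z \<in> carrier P'"
      using f g h by (auto simp: linear_maps_def)
    ultimately show "tensor_assoc R M' N' P' (tensor_map R M' (tensor R N' P') f (tensor_map R N' P' g h)
          (pure_tensor R M (tensor R N P) x (pure_tensor R N P y z))) =
        tensor_map R (tensor R M' N') P' (tensor_map R M' N' f g) h
          (tensor_assoc R M N P (pure_tensor R M (tensor R N P) x (pure_tensor R N P y z)))"
      using assms(1-7)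
      by (simp add: fg(2) gh(2) f_gh(2) fg_h(2) as(2) as'(2) pure_tensor_closed)
  qed
qed

text \<open>Both sides send x \<otimes> y to f y \<otimes> f x. The same map must act on both
  factors, as \<open>a\<close> does in \<open>Q\<close>.\<close>

lemma tensor_swap_natural:
  assumes "\<one>\<^bsub>R\<^esub> \<noteq> \<zero>\<^bsub>R\<^esub>" "module R M" "module R N" and f: "f \<in> linear_maps R M N"
    and t: "t \<in> carrier (tensor R M M)"
  shows "tensor_swap R N (tensor_map R N N f f t) = tensor_map R N N f f (tensor_swap R M t)"
proof -
  note ff = tensor_map_linear[OF assms(1,2,2,3,3) f f]
    and sw = tensor_swap_linear[OF assms(1,2)] and sw' = tensor_swap_linear[OF assms(1,3)]
  show ?thesis
  proof (rule linear_maps_tensor_eqI[OF assms(1,2,2) tensor_module[OF assms(3,3)]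
        linear_maps_comp[OF ff(1) sw'(1)] linear_maps_comp[OF sw(1) ff(1)] _ t])
    fix x y assume "x \<in> carrier M" "y \<in> carrier M"
    moreover from this have "f x \<in> carrier N" "f y \<in> carrier N"
      using f by (auto simp: linear_maps_def)
    ultimately show "tensor_swap R N (tensor_map R N N f f (pure_tensor R M M x y)) =
        tensor_map R N N f f (tensor_swap R M (pure_tensor R M M x y))"
      by (simp add: ff(2) sw(2) sw'(2))
  qed
qed

lemma tensor_map_id:
  assumes "\<one>\<^bsub>R\<^esub> \<noteq> \<zero>\<^bsub>R\<^esub>" "module R M" "module R N" "t \<in> carrier (tensor R M N)"
  shows "tensor_map R M N id id t = t"
  by (rule linear_maps_tensor_eqI[OF assms(1-3) tensor_module[OF assms(2,3)]
        tensor_map_linear(1)[OF assms(1-3,2,3) linear_maps_id linear_maps_id]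
        linear_maps_id[unfolded id_def] _ assms(4)])
    (simp add: tensor_map_linear(2)[OF assms(1-3,2,3) linear_maps_id linear_maps_id])

text \<open>Compatibility with \<open>f\<close> passes to its iterates: \<open>comm\<close> is
  applied at the point \<open>(f ^^ n) x\<close>, and functoriality merges the new f \<otimes> f
  with the n-th power from the induction hypothesis. The case n = 0 is id \<otimes> id = id.\<close>

lemma funpow_comultiplicative:
  assumes "\<one>\<^bsub>R\<^esub> \<noteq> \<zero>\<^bsub>R\<^esub>" "module R L" and f: "f \<in> linear_maps R L L"
    and \<kappa>: "\<kappa> \<in> linear_maps R L (tensor R L L)"
    and comm: "\<And>x. x \<in> carrier L \<Longrightarrow> \<kappa> (f x) = tensor_map R L L f f (\<kappa> x)"
    and x: "x \<in> carrier L"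
  shows "\<kappa> ((f ^^ n) x) = tensor_map R L L (f ^^ n) (f ^^ n) (\<kappa> x)"
proof (induction n)
  case 0
  have "\<kappa> x \<in> carrier (tensor R L L)" using \<kappa> x by (auto simp: linear_maps_def)
  then show ?case by (simp add: tensor_map_id[OF assms(1,2,2), unfolded id_def] id_def)
next
  case (Suc n)
  note fn = linear_maps_funpow[OF f]
  have "(f ^^ n) x \<in> carrier L" "\<kappa> x \<in> carrier (tensor R L L)"
    using fn[of n] \<kappa> x by (auto simp: linear_maps_def)
  then show ?case
    using tensor_map_comp[OF assms(1,2,2,2,2,2,2) fn fn f f fn[of "Suc n"] fn[of "Suc n"]] Suc
    by (simp add: comm comp_def)
qed

theorem theorem5p8:
  fixes R :: "('f, 'r) ring_scheme" and L :: "('f, 'l, 's) module_scheme"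
    and M :: "('f, 'm, 't) module_scheme"
    and \<gamma> \<Delta> :: "'l \<Rightarrow> ('l \<times> 'l \<Rightarrow> 'f) set" and \<alpha> :: "'l \<Rightarrow> 'l"
    and \<delta> \<beta> :: "'m \<Rightarrow> ('l \<times> 'm \<Rightarrow> 'f) set" and \<alpha>\<^sub>M :: "'m \<Rightarrow> 'm"
    and n :: nat
  assumes comodule: "post_hom_lie_comodule R L \<gamma> \<Delta> \<alpha> M \<delta> \<beta> \<alpha>\<^sub>M"
    and \<Delta>_\<alpha>: "\<And>x. x \<in> carrier L \<Longrightarrow> \<Delta> (\<alpha> x) = tensor_map R L L \<alpha> \<alpha> (\<Delta> x)"
  shows "post_hom_lie_comodule R L \<gamma> \<Delta> \<alpha> M
           (tensor_map R L M (\<alpha> ^^ n) id \<circ> \<delta>)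
           (tensor_map R L M (\<alpha> ^^ n) id \<circ> \<beta>) \<alpha>\<^sub>M"
proof -
  interpret C: post_hom_lie_comodule R L \<gamma> \<Delta> \<alpha> M \<delta> \<beta> \<alpha>\<^sub>M by fact
  have nz: "\<one>\<^bsub>R\<^esub> \<noteq> \<zero>\<^bsub>R\<^esub>" by simp
  note L = C.L.module_axioms and M = C.M.module_axioms
  note LL = tensor_module[OF L L] and LM = tensor_module[OF L M]
  let ?LL = "tensor R L L" and ?LM = "tensor R L M"
  note T = tensor_module[OF LL M]
  define a where "a = \<alpha> ^^ n"
  have a: "a \<in> linear_maps R L L" unfolding a_def by (rule linear_maps_funpow[OF C.\<alpha>_linear])
  have a_\<alpha>: "a (\<alpha> x) = \<alpha> (a x)" for x by (simp add: a_def funpow_swap1)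
  define A where "A = tensor_map R L M a id"
  define Q where "Q = tensor_map R ?LL M (tensor_map R L L a a) id"
  define \<tau> where "\<tau> = tensor_map R ?LL M (tensor_swap R L) id"
  note aa = tensor_map_linear(1)[OF nz L L L L a a]
  note swap = tensor_swap_linear(1)[OF nz L]
  have A: "A \<in> linear_maps R ?LM ?LM"
    unfolding A_def by (rule tensor_map_linear(1)[OF nz L M L M a linear_maps_id])
  have Q: "Q \<in> linear_maps R (tensor R ?LL M) (tensor R ?LL M)"
    unfolding Q_def by (rule tensor_map_linear(1)[OF nz LL M LL M aa linear_maps_id])
  have \<tau>: "\<tau> \<in> linear_maps R (tensor R ?LL M) (tensor R ?LL M)"
    unfolding \<tau>_def by (rule tensor_map_linear(1)[OF nz LL M LL M swap linear_maps_id])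
  \<comment> \<open>The square in the first factor is naturality of the swap for \<open>a\<close>;
    the one in the second consists of identities.\<close>
  have \<tau>_Q: "\<tau> (Q t) = Q (\<tau> t)" if "t \<in> carrier (tensor R ?LL M)" for t
    unfolding \<tau>_def Q_def
    by (rule tensor_map_comm[OF nz LL M LL M LL M LL M aa linear_maps_id swap linear_maps_id
          swap linear_maps_id aa linear_maps_id tensor_swap_natural[OF nz L L a] refl that])
  have A_\<alpha>: "A (tensor_map R L M \<alpha> \<alpha>\<^sub>M t) = tensor_map R L M \<alpha> \<alpha>\<^sub>M (A t)" if "t \<in> carrier ?LM" for t
    unfolding A_def
    by (rule tensor_map_comm[OF nz L M L M L M L M C.\<alpha>_linear C.\<alpha>\<^sub>M_linear a linear_maps_id
          a linear_maps_id C.\<alpha>_linear C.\<alpha>\<^sub>M_linear a_\<alpha> _ that]) simp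
  have \<kappa>_A: "tensor_map R ?LL M \<kappa> \<alpha>\<^sub>M (A t) = Q (tensor_map R ?LL M \<kappa> \<alpha>\<^sub>M t)"
    if \<kappa>: "\<kappa> \<in> linear_maps R L ?LL"
      and "\<And>x. x \<in> carrier L \<Longrightarrow> \<kappa> (\<alpha> x) = tensor_map R L L \<alpha> \<alpha> (\<kappa> x)"
      and t: "t \<in> carrier ?LM" for \<kappa> t
    unfolding A_def Q_def
    by (rule tensor_map_comm[OF nz L M L M LL M LL M a linear_maps_id \<kappa> C.\<alpha>\<^sub>M_linear
          \<kappa> C.\<alpha>\<^sub>M_linear aa linear_maps_id _ _ t])
      (simp_all add: a_def funpow_comultiplicative[OF nz L C.\<alpha>_linear that(1,2)])
  \<comment> \<open>For \<gamma> the compatibility with \<alpha> is a coalgebra axiom. For \<Delta>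
    it is not implied by the axioms, and the hypothesis \<open>\<Delta>_\<alpha>\<close> supplies
    it.\<close>
  note \<gamma>_A = \<kappa>_A[OF C.\<gamma>_linear C.\<gamma>_\<alpha>] and \<Delta>_A = \<kappa>_A[OF C.\<Delta>_linear \<Delta>_\<alpha>]
  have assoc_closed: "tensor_assoc R L L M (tensor_map R L ?LM \<alpha> \<epsilon> t) \<in> carrier (tensor R ?LL M)"
    if "\<epsilon> \<in> linear_maps R M ?LM" "t \<in> carrier ?LM" for \<epsilon> t
    using linear_maps_comp[OF tensor_map_linear(1)[OF nz L M L LM C.\<alpha>_linear that(1)]
        tensor_assoc_linear(1)[OF nz L L M]] that(2)
    by (auto simp: linear_maps_def)
  \<comment> \<open>The two copies of \<open>A\<close> act on different legs: the outer one puts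
    \<open>a\<close> on the first factor L, the one inside \<open>A \<circ> \<epsilon>\<close> puts
    \<open>a\<close> on the L produced by \<epsilon>.\<close>
  have assoc_A: "tensor_assoc R L L M (tensor_map R L ?LM \<alpha> (A \<circ> \<epsilon>) (A t)) =
      Q (tensor_assoc R L L M (tensor_map R L ?LM \<alpha> \<epsilon> t))"
    if \<epsilon>: "\<epsilon> \<in> linear_maps R M ?LM" and t: "t \<in> carrier ?LM" for \<epsilon> t
  proof -
    have A\<epsilon>: "A \<circ> \<epsilon> \<in> linear_maps R M ?LM"
      using linear_maps_comp[OF \<epsilon> A] by (simp add: comp_def)
    have "tensor_map R L ?LM \<alpha> (A \<circ> \<epsilon>) (A t) =
        tensor_map R L ?LM a A (tensor_map R L ?LM \<alpha> \<epsilon> t)"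
      \<comment> \<open>Only the application to \<open>t\<close> is expanded. The other occurrences
        of \<open>A\<close> stay whole, as edges of the square in the second factor.\<close>
      unfolding A_def[THEN fun_cong, of t]
      by (rule tensor_map_comm[OF nz L M L M L LM L LM a linear_maps_id C.\<alpha>_linear A\<epsilon>
            C.\<alpha>_linear \<epsilon> a A _ _ t]) (simp_all add: a_\<alpha>)
    moreover have "tensor_map R L ?LM \<alpha> \<epsilon> t \<in> carrier (tensor R L ?LM)"
      using tensor_map_linear(1)[OF nz L M L LM C.\<alpha>_linear \<epsilon>] t by (auto simp: linear_maps_def)
    ultimately show ?thesis
      using tensor_assoc_natural[OF nz L L M L L M a a linear_maps_id]
      by (simp add: A_def Q_def)
  qed
  have cl: "\<delta> m \<in> carrier ?LM" "\<beta> m \<in> carrier ?LM" if "m \<in> carrier M" for m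
    using that C.\<delta>_linear C.\<beta>_linear by (auto simp: linear_maps_def)
  have \<tau>_cl: "\<tau> t \<in> carrier (tensor R ?LL M)" if "t \<in> carrier (tensor R ?LL M)" for t
    using \<tau> that by (auto simp: linear_maps_def)
  have \<Delta>_cl: "tensor_map R ?LL M \<Delta> \<alpha>\<^sub>M t \<in> carrier (tensor R ?LL M)" if "t \<in> carrier ?LM" for t
    using tensor_map_linear(1)[OF nz L M LL M C.\<Delta>_linear C.\<alpha>\<^sub>M_linear] that
    by (auto simp: linear_maps_def)
  note Q_minus = linear_maps_minus[OF T T Q]
  have Q_add: "Q (s \<oplus>\<^bsub>tensor R ?LL M\<^esub> t) = Q s \<oplus>\<^bsub>tensor R ?LL M\<^esub> Q t"
    if "s \<in> carrier (tensor R ?LL M)" "t \<in> carrier (tensor R ?LL M)" for s t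
    using Q that by (auto simp: linear_maps_def)
  interpret T: module R "tensor R ?LL M" by (rule T)
  note simps = assoc_A assoc_closed \<gamma>_A \<Delta>_A \<tau>_Q \<tau>_cl \<Delta>_cl cl C.\<delta>_linear C.\<beta>_linear
  have "post_hom_lie_comodule R L \<gamma> \<Delta> \<alpha> M (A \<circ> \<delta>) (A \<circ> \<beta>) \<alpha>\<^sub>M"
  \<comment> \<open>The coalgebra is unchanged, so its axioms come from \<open>C\<close>; only the
    comodule axioms for the new maps remain.\<close>
  proof (unfold_locales, unfold Let_def, fold \<tau>_def)
    show "A \<circ> \<delta> \<in> linear_maps R M ?LM" "A \<circ> \<beta> \<in> linear_maps R M ?LM"
      using linear_maps_comp[OF C.\<delta>_linear A] linear_maps_comp[OF C.\<beta>_linear A]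
      by (simp_all add: comp_def)
    fix m assume m: "m \<in> carrier M"
    show "(A \<circ> \<delta>) (\<alpha>\<^sub>M m) = tensor_map R L M \<alpha> \<alpha>\<^sub>M ((A \<circ> \<delta>) m)"
      "(A \<circ> \<beta>) (\<alpha>\<^sub>M m) = tensor_map R L M \<alpha> \<alpha>\<^sub>M ((A \<circ> \<beta>) m)"
      using m by (simp_all add: C.\<delta>_\<alpha>\<^sub>M C.\<beta>_\<alpha>\<^sub>M A_\<alpha> cl)
    let ?assoc = "\<lambda>\<epsilon> t. tensor_assoc R L L M (tensor_map R L ?LM \<alpha> \<epsilon> t)"
    \<comment> \<open>From here on each identity is the image under \<open>Q\<close> of the
      corresponding one for \<delta> and \<beta>, so injectivity of \<open>Q\<close> is never an
      issue.\<close>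
    show "tensor_map R ?LL M \<gamma> \<alpha>\<^sub>M ((A \<circ> \<delta>) m) =
        ?assoc (A \<circ> \<delta>) ((A \<circ> \<delta>) m) \<ominus>\<^bsub>tensor R ?LL M\<^esub> \<tau> (?assoc (A \<circ> \<delta>) ((A \<circ> \<delta>) m))"
      using m C.comodule_\<delta>\<delta>[OF m, unfolded Let_def, folded \<tau>_def] by (simp add: simps Q_minus)
    show "tensor_map R ?LL M \<Delta> \<alpha>\<^sub>M ((A \<circ> \<delta>) m) =
        ?assoc (A \<circ> \<delta>) ((A \<circ> \<beta>) m) \<ominus>\<^bsub>tensor R ?LL M\<^esub> \<tau> (?assoc (A \<circ> \<beta>) ((A \<circ> \<delta>) m))"
      using m C.comodule_\<delta>\<beta>[OF m, unfolded Let_def, folded \<tau>_def] by (simp add: simps Q_minus)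
    \<comment> \<open>The right-hand side mixes associator terms with \<Delta> terms, so
      \<open>assoc_A\<close> and \<open>\<Delta>_A\<close> must produce the same
      \<open>Q\<close>.\<close>
    show "tensor_map R ?LL M \<gamma> \<alpha>\<^sub>M ((A \<circ> \<beta>) m) =
        (?assoc (A \<circ> \<beta>) ((A \<circ> \<beta>) m) \<ominus>\<^bsub>tensor R ?LL M\<^esub> \<tau> (?assoc (A \<circ> \<beta>) ((A \<circ> \<beta>) m)))
        \<oplus>\<^bsub>tensor R ?LL M\<^esub>
        (\<tau> (tensor_map R ?LL M \<Delta> \<alpha>\<^sub>M ((A \<circ> \<beta>) m))
          \<ominus>\<^bsub>tensor R ?LL M\<^esub> tensor_map R ?LL M \<Delta> \<alpha>\<^sub>M ((A \<circ> \<beta>) m))"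
      using m C.comodule_\<beta>\<beta>[OF m, unfolded Let_def, folded \<tau>_def]
      by (simp add: simps Q_minus Q_add)
  qed (rule C.\<alpha>\<^sub>M_linear)
  then show ?thesis by (simp add: A_def a_def)
qed

end
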